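(* Let $\alpha^+,\lambda^+,\alpha^-,\lambda^-\in(0,\infty)$ and $\beta^+,\beta^-\in[0,1)$, let $X\sim\mathrm{TS}(\alpha^+,\beta^+,\lambda^+;\alpha^-,\beta^-,\lambda^-)$ be a tempered stable process, set $\mu:=\mathbb{E}[X_1]$ and $\sigma^2:=\mathrm{Var}[X_1]$ (with $\sigma>0$), and let $W$ be a Brownian motion with $W_1\sim N(\mu,\sigma^2)$. Then for all $t>0$ $$\sup_{x\in\mathbb{R}}|G_{X_t}(x)-G_{W_t}(x)|\le\frac{32c}{\sqrt t}\bigg[(1-\beta^+)(2-\beta^+)\frac{(1-\beta^-)\mu/\sigma^3+\lambda^-/\sigma}{\lambda^+((1-\beta^-)\lambda^++(1-\beta^+)\lambda^-)}+(1-\beta^-)(2-\beta^-)\frac{(\beta^+-1)\mu/\sigma^3+\lambda^+/\sigma}{\lambda^-((1-\beta^-)\lambda^++(1-\beta^+)\lambda^-)}\bigg],$$ and the right-hand side converges to $0$ as $t\to\infty$.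
   Context: For $\alpha^+,\lambda^+,\alpha^-,\lambda^-\in(0,\infty)$ and $\beta^+,\beta^-\in[0,1)$, the tempered stable distribution $\mathrm{TS}(\alpha^+,\beta^+,\lambda^+;\alpha^-,\beta^-,\lambda^-)$ is the infinitely divisible distribution on $\mathbb{R}$ with characteristic function $\varphi(z)=\exp\big(\int_{\mathbb{R}}(e^{izx}-1)F(dx)\big)$, $z\in\mathbb{R}$, where $$F(dx)=\Big(\frac{\alpha^+}{x^{1+\beta^+}}e^{-\lambda^+x}\mathbf{1}_{(0,\infty)}(x)+\frac{\alpha^-}{|x|^{1+\beta^-}}e^{-\lambda^-|x|}\mathbf{1}_{(-\infty,0)}(x)\Big)dx.$$ A tempered stable process $X\sim\mathrm{TS}(\alpha^+,\beta^+,\lambda^+;\alpha^-,\beta^-,\lambda^-)$ is a Lévy process such that $X_1$ has this distribution. $G_Y$ denotes the distribution function of a random variable $Y$. "Brownian motion $W$ with $W_1\sim N(\mu,\sigma^2)$" means Brownian motion with drift, so $W_t\sim N(\mu t,\sigma^2t)$. The number $c>0$ denotes the constant from the Berry--Esseen theorem, i.e. a constant such that for every i.i.d. sequence $(Y_j)_{j\in\mathbb{N}}$ with mean $m$, variance $s^2>0$ and $\mathbb{E}[|Y_1-m|^3]<\infty$ and every $n\in\mathbb{N}$, the distribution function of $(Y_1+\dots+Y_n-nm)/(s\sqrt n)$ differs from the standard normal distribution function in supremum norm by at most $c\,\mathbb{E}[|Y_1-m|^3]/(s^3\sqrt n)$. *)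

theory Defs
  imports "HOL-Probability.Probability"
begin

text \<open>
  Processes have type \<^typ>\<open>real \<Rightarrow> 'a \<Rightarrow> real\<close>, but only the times in \<open>[0, \<infinity>)\<close> are
  constrained.
\<close>

locale indep_increments_process = prob_space M
  for M :: "'a measure" and X :: "real \<Rightarrow> 'a \<Rightarrow> real" +
  assumes rv: "\<And>t. 0 \<le> t \<Longrightarrow> random_variable borel (X t)"
    and initial: "AE \<omega> in M. X 0 \<omega> = 0"
    and indep_increments: "\<And>(n :: nat) \<tau>. 0 \<le> \<tau> 0 \<Longrightarrow> (\<forall>i<n. \<tau> i < \<tau> (Suc i)) \<Longrightarrow>
      indep_vars (\<lambda>_. borel) (\<lambda>i \<omega>. X (\<tau> (Suc i)) \<omega> - X (\<tau> i) \<omega>) {..<n}"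

definition cadlag :: "(real \<Rightarrow> real) \<Rightarrow> bool" where
  "cadlag f \<longleftrightarrow> (\<forall>t\<ge>0. (f \<longlongrightarrow> f t) (at_right t)) \<and> (\<forall>t>0. \<exists>l. (f \<longlongrightarrow> l) (at_left t))"

locale levy_process = indep_increments_process +
  assumes stationary_increments: "\<And>s t. 0 \<le> s \<Longrightarrow> 0 \<le> t \<Longrightarrow>
      distr M borel (\<lambda>\<omega>. X (s + t) \<omega> - X s \<omega>) = distr M borel (X t)"
    and stochastically_continuous: "\<And>t \<epsilon>. 0 \<le> t \<Longrightarrow> 0 < \<epsilon> \<Longrightarrow>
      ((\<lambda>s. prob {\<omega> \<in> space M. \<bar>X s \<omega> - X t \<omega>\<bar> > \<epsilon>}) \<longlongrightarrow> 0) (at t within {0..})"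
    and cadlag_paths: "AE \<omega> in M. cadlag (\<lambda>t. X t \<omega>)"

text \<open>Brownian motion with drift \<open>\<mu>\<close>; \<^const>\<open>normal_density\<close> takes the standard deviation, not
  the variance.\<close>

locale brownian_motion = indep_increments_process M W
  for M :: "'a measure" and W :: "real \<Rightarrow> 'a \<Rightarrow> real" and \<mu> \<sigma> :: real +
  assumes normal_increments: "\<And>s t. 0 \<le> s \<Longrightarrow> s < t \<Longrightarrow>
      distributed M lborel (\<lambda>\<omega>. W t \<omega> - W s \<omega>) (normal_density (\<mu> * (t - s)) (\<sigma> * sqrt (t - s)))"
    and continuous_paths: "AE \<omega> in M. continuous_on {0..} (\<lambda>t. W t \<omega>)"

text \<open>
  Suffixes \<open>p\<close>, \<open>m\<close> stand for the superscripts \<open>+\<close>, \<open>-\<close>; \<open>lp\<close>, \<open>lm\<close> are the tempering rates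
  \<open>\<lambda>\<^sup>+\<close>, \<open>\<lambda>\<^sup>-\<close>.
\<close>

definition ts_levy_density ::
    "real \<Rightarrow> real \<Rightarrow> real \<Rightarrow> real \<Rightarrow> real \<Rightarrow> real \<Rightarrow> real \<Rightarrow> real" where
  "ts_levy_density \<alpha>p \<beta>p lp \<alpha>m \<beta>m lm x =
     \<alpha>p / x powr (1 + \<beta>p) * exp (- lp * x) * indicator {0<..} x
   + \<alpha>m / \<bar>x\<bar> powr (1 + \<beta>m) * exp (- lm * \<bar>x\<bar>) * indicator {..<0} x"

definition ts_levy_measure ::
    "real \<Rightarrow> real \<Rightarrow> real \<Rightarrow> real \<Rightarrow> real \<Rightarrow> real \<Rightarrow> real measure" where
  "ts_levy_measure \<alpha>p \<beta>p lp \<alpha>m \<beta>m lm =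
     density lborel (\<lambda>x. ennreal (ts_levy_density \<alpha>p \<beta>p lp \<alpha>m \<beta>m lm x))"

text \<open>
  A predicate, since existence is not established here. A law with this characteristic function is
  unique (\<open>Levy_uniqueness\<close>) and automatically infinitely divisible: its \<open>n\<close>-th root is the law
  with \<open>\<alpha>p / n\<close>, \<open>\<alpha>m / n\<close> in place of \<open>\<alpha>p\<close>, \<open>\<alpha>m\<close>.
\<close>

definition tempered_stable_distribution ::
    "real \<Rightarrow> real \<Rightarrow> real \<Rightarrow> real \<Rightarrow> real \<Rightarrow> real \<Rightarrow> real measure \<Rightarrow> bool" where
  "tempered_stable_distribution \<alpha>p \<beta>p lp \<alpha>m \<beta>m lm \<nu> \<longleftrightarrow>
     real_distribution \<nu> \<and>
     (\<forall>z. char \<nu> z =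
        exp (CLINT x | ts_levy_measure \<alpha>p \<beta>p lp \<alpha>m \<beta>m lm. iexp (z * x) - 1))"

locale tempered_stable_process = levy_process M X
  for M :: "'a measure" and X :: "real \<Rightarrow> 'a \<Rightarrow> real"
    and \<alpha>p \<beta>p lp \<alpha>m \<beta>m lm :: real +
  assumes law_1: "tempered_stable_distribution \<alpha>p \<beta>p lp \<alpha>m \<beta>m lm (distr M borel (X 1))"

text \<open>
  The probability spaces range over measures on \<^typ>\<open>nat \<Rightarrow> real\<close>. This is no restriction: the
  inequality depends only on the joint law of the sequence, and every law of a real sequence is
  realised by the coordinate functions on this type.
\<close>

definition berry_esseen_constant :: "real \<Rightarrow> bool" where
  "berry_esseen_constant c \<longleftrightarrow> c > 0 \<and>
    (\<forall>(P :: (nat \<Rightarrow> real) measure) Y m s n.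
       prob_space P \<longrightarrow>
       prob_space.indep_vars P (\<lambda>_. borel) Y UNIV \<longrightarrow>
       (\<forall>j. distr P borel (Y j) = distr P borel (Y 0)) \<longrightarrow>
       m = prob_space.expectation P (Y 0) \<longrightarrow>
       s > 0 \<longrightarrow>
       s\<^sup>2 = prob_space.variance P (Y 0) \<longrightarrow>
       integrable P (\<lambda>\<omega>. \<bar>Y 0 \<omega> - m\<bar> ^ 3) \<longrightarrow>
       n \<ge> 1 \<longrightarrow>
       (SUP x. \<bar>cdf (distr P borel (\<lambda>\<omega>. ((\<Sum>j<n. Y j \<omega>) - real n * m) / (s * sqrt (real n)))) x
                - cdf std_normal_distribution x\<bar>)
       \<le> c * prob_space.expectation P (\<lambda>\<omega>. \<bar>Y 0 \<omega> - m\<bar> ^ 3) / (s ^ 3 * sqrt (real n)))"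

end

theory Submission
  imports Defs
begin

text \<open>
  Up to the factor \<open>32\<close> the right-hand side is \<open>c \<kappa>\<^sub>3 / (\<sigma>\<^sup>3 sqrt t)\<close>, where \<open>\<kappa>\<^sub>3\<close> is the third absolute
  moment of the Levy measure \<open>F\<close>: the formulas for \<open>\<mu>\<close> and \<open>\<sigma>\<^sup>2\<close> form a linear system for the two
  summands of the first moment of \<open>F\<close>, and the third moment is a linear combination of these.
  Writing \<open>X\<^sub>t\<close> as a sum of \<open>n\<close> independent copies of \<open>X\<^sub>h\<close>, \<open>h = t / n\<close>, the Berry--Esseen theorem yields
  the bound \<open>c n E|X\<^sub>h - h \<mu>|\<^sup>3 / (\<sigma>\<^sup>3 t sqrt t)\<close>, and \<open>n \<rightarrow> \<infinity>\<close> gives the claim, even without the factor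
  \<open>32\<close>, once \<open>E|X\<^sub>h - h \<mu>|\<^sup>3 \<le> h \<kappa>\<^sub>3 + O(h\<^sup>2)\<close> is known. To see the latter, represent \<open>|x|\<^sup>3\<close> as a constant
  times the integral over \<open>z > 0\<close> of the nonnegative kernel \<open>(cos (z x) - 1 + z\<^sup>2 x\<^sup>2 / 2) / z\<^sup>4\<close>. By Tonelli's
  theorem the third absolute moments of \<open>X\<^sub>h - h \<mu>\<close> and of \<open>F\<close> become integrals of \<open>exp (h \<psi>)\<close> and of \<open>\<psi>\<close>,
  for the compensated exponent \<open>\<psi>\<close>, and \<open>|exp w - 1 - w| \<le> |w|\<^sup>2\<close> for \<open>Re w \<le> 0\<close> compares the two.
\<close>

section \<open>Representation of the absolute third moment\<close>

lemma cos_minus_quadratic_nonneg: "0 \<le> cos u - 1 + u\<^sup>2 / 2" for u :: real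
proof -
  have "1 - cos u = 2 * (sin (u / 2))\<^sup>2"
    using cos_double_sin[of "u / 2"] by simp
  moreover have "(sin (u / 2))\<^sup>2 \<le> (u / 2)\<^sup>2"
    using abs_sin_x_le_abs_x[of "u / 2"] by (simp only: abs_le_square_iff)
  ultimately show ?thesis
    by (simp add: power_divide)
qed

text \<open>Two bounds in one: \<open>u ^ 4 / 24\<close> from Taylor's formula for small
  \<open>u\<close>, and \<open>u\<^sup>2 / 2\<close> for large \<open>u\<close>. Divided by
  \<open>u ^ 4\<close>, the product form yields the integrable majorant
  \<open>1 / (1 + u\<^sup>2)\<close>.\<close>

lemma cos_minus_quadratic_le:
  fixes u :: real
  shows "(cos u - 1 + u\<^sup>2 / 2) * (1 + u\<^sup>2) \<le> u ^ 4"
proof -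
  let ?g = "cos u - 1 + u\<^sup>2 / 2"
  \<comment> \<open>The cubic Taylor term is purely imaginary; including it leaves the real part
    unchanged and gains one order in the remainder.\<close>
  define E where "E = (\<Sum>k\<le>3. (\<i> * complex_of_real u) ^ k / fact k)"
  have "Re (iexp u - E) = ?g"
    by (simp add: E_def numeral_eq_Suc Re_exp power2_eq_square)
  moreover have "cmod (iexp u - E) \<le> \<bar>u\<bar> ^ Suc 3 / fact (Suc 3)"
    unfolding E_def by (rule iexp_approx1)
  ultimately have 1: "?g \<le> u ^ 4 / 24"
    using complex_Re_le_cmod[of "iexp u - E"] by (simp add: fact_numeral power_even_abs)
  have "?g \<le> u\<^sup>2 / 2"
    by simp
  then have 2: "?g * u\<^sup>2 \<le> u\<^sup>2 / 2 * u\<^sup>2"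
    by (rule mult_right_mono) simp
  have "u\<^sup>2 / 2 * u\<^sup>2 = u ^ 4 / 2"
    by (simp add: power2_eq_square power4_eq_xxxx)
  moreover have "0 \<le> u ^ 4"
    by simp
  ultimately show ?thesis
    using 1 2 by (simp only: distrib_left mult_1_right)
qed

text \<open>Taylor's formula on the convex half-plane \<open>Re z \<le> 0\<close>, where
  \<open>exp\<close> is bounded by 1. The constant is therefore uniform, as required for exponents
  of arbitrary size.\<close>

lemma cmod_exp_minus_linear_le:
  fixes w :: complex
  assumes "Re w \<le> 0"
  shows "cmod (exp w - 1 - w) \<le> (cmod w)\<^sup>2"
proof -
  have "cmod (exp w - (\<Sum>i\<le>1. exp 0 * (w - 0) ^ i / fact i)) \<le> 1 * cmod (w - 0) ^ Suc 1 / fact 1"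
    by (rule complex_Taylor[where f = "\<lambda>_. exp" and S = "{z. Re z \<le> 0}"])
       (use assms in \<open>auto intro!: convex_halfspace_Re_le DERIV_subset[OF DERIV_exp]\<close>)
  then show ?thesis
    by (simp add: algebra_simps power2_eq_square)
qed

lemma cmod_exp_minus_one_le:
  fixes w :: complex
  assumes "Re w \<le> 0"
  shows "cmod (exp w - 1) \<le> cmod w"
proof -
  have "cmod (exp w - (\<Sum>i\<le>0. exp 0 * (w - 0) ^ i / fact i)) \<le> 1 * cmod (w - 0) ^ Suc 0 / fact 0"
    by (rule complex_Taylor[where f = "\<lambda>_. exp" and S = "{z. Re z \<le> 0}"])
       (use assms in \<open>auto intro!: convex_halfspace_Re_le DERIV_subset[OF DERIV_exp]\<close>)
  then show ?thesis
    by simp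
qed

text \<open>Values in \<open>ennreal\<close> allow Tonelli's theorem before any moment is known to
  be finite; the conversion cuts nothing off, by \<open>cos_minus_quadratic_nonneg\<close>. The
  indicator restricts \<open>z\<close> to the half-line, so that the integrals can run over
  \<open>lborel\<close>.\<close>

definition cubic_kernel :: "real \<Rightarrow> real \<Rightarrow> ennreal" where
  "cubic_kernel z x = ennreal (indicator {0<..} z * (cos (z * x) - 1 + (z * x)\<^sup>2 / 2) / z ^ 4)"

lemma measurable_cubic_kernel[measurable (raw)]:
  assumes [measurable]: "f \<in> borel_measurable M" "g \<in> borel_measurable M"
  shows "(\<lambda>x. cubic_kernel (f x) (g x)) \<in> borel_measurable M"
  unfolding cubic_kernel_def by measurable

text \<open>What matters is that this lies strictly between 0 and infinity: it multiplies both third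
  moments in the later comparison and is divided out there.\<close>

definition cubic_constant :: ennreal where
  "cubic_constant = (\<integral>\<^sup>+z. cubic_kernel z 1 \<partial>lborel)"

lemma nn_integral_cauchy_kernel:
  "(\<integral>\<^sup>+z. ennreal (indicator {0<..} z / (1 + z\<^sup>2)) \<partial>lborel) < \<infinity>"
proof -
  have "(\<integral>\<^sup>+z. ennreal (indicator {0<..} z / (1 + z\<^sup>2)) \<partial>lborel)
      \<le> (\<integral>\<^sup>+z. ennreal (1 / (1 + z\<^sup>2)) * indicator {0..} z \<partial>lborel)"
    by (intro nn_integral_mono) (auto simp: indicator_def)
  also have "\<dots> = ennreal (pi / 2 - arctan 0)"
  proof (rule nn_integral_FTC_atLeast)
    show "(arctan \<longlongrightarrow> pi / 2) at_top"
      by (rule tendsto_arctan_at_top)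
  qed (auto intro!: derivative_eq_intros simp: field_simps)
  finally show ?thesis
    by (rule le_less_trans) simp
qed

lemma cubic_constant_finite: "cubic_constant < \<infinity>"
proof -
  have "cubic_kernel z 1 \<le> ennreal (indicator {0<..} z / (1 + z\<^sup>2))" for z
  proof (cases "z > 0")
    case True
    then show ?thesis
      using cos_minus_quadratic_le[of z]
      by (auto simp: cubic_kernel_def intro!: ennreal_leI simp: field_simps add_pos_nonneg)
  qed (simp add: cubic_kernel_def)
  then show ?thesis
    unfolding cubic_constant_def
    by (intro le_less_trans[OF nn_integral_mono nn_integral_cauchy_kernel])
qed

lemma cubic_constant_pos: "0 < cubic_constant"
proof -
  \<comment> \<open>On \<open>{3..4}\<close> the numerator is at least \<open>9 / 2 - 2\<close> and
    \<open>z ^ 4 \<le> 256\<close>, which gives this crude minorant.\<close>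
  have "ennreal (1 / 256) * indicator {3..4} z \<le> cubic_kernel z 1" for z :: real
  proof (cases "z \<in> {3..4}")
    case True
    have "3\<^sup>2 \<le> z\<^sup>2" "z ^ 4 \<le> 4 ^ 4"
      using True power_mono[of 3 z 2] power_mono[of z 4 4] by simp_all
    then have "1 / 256 \<le> 1 / z ^ 4" "1 \<le> cos z - 1 + z\<^sup>2 / 2"
      using True cos_ge_minus_one[of z] by (simp_all add: field_simps del: cos_ge_minus_one)
    moreover have "1 / z ^ 4 \<le> (cos z - 1 + z\<^sup>2 / 2) / z ^ 4"
      using calculation True by (intro divide_right_mono) auto
    ultimately show ?thesis
      using True by (auto simp: cubic_kernel_def intro!: ennreal_leI)
  qed simp
  then have "(\<integral>\<^sup>+z. ennreal (1 / 256) * indicator {3..4::real} z \<partial>lborel) \<le> cubic_constant"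
    unfolding cubic_constant_def by (intro nn_integral_mono)
  moreover have "(\<integral>\<^sup>+z. ennreal (1 / 256) * indicator {3..4::real} z \<partial>lborel) = ennreal (1 / 256)"
    by (subst nn_integral_cmult_indicator) auto
  ultimately show ?thesis
    by (metis ennreal_less_zero_iff less_le_trans zero_less_divide_1_iff zero_less_numeral)
qed

text \<open>Substitute \<open>\<bar>x\<bar> * z\<close> for \<open>z\<close>: the kernel contributes
  four powers of \<open>\<bar>x\<bar>\<close> and the differential takes one away. Evenness of the
  cosine absorbs the sign of \<open>x\<close>.\<close>

lemma nn_integral_cubic_kernel:
  "(\<integral>\<^sup>+z. cubic_kernel z x \<partial>lborel) = cubic_constant * ennreal (\<bar>x\<bar> ^ 3)"
proof (cases "x = 0")
  case True
  then show ?thesis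
    by (simp add: cubic_kernel_def)
next
  case False
  define a where "a = \<bar>x\<bar>"
  have a: "a > 0"
    using False by (simp add: a_def)
  have scale: "ennreal (a ^ 4) * cubic_kernel (a * z) 1 = cubic_kernel z x" for z
  proof -
    have "cos (z * a) = cos (z * x)"
      unfolding a_def by (cases "x \<ge> 0") auto
    then show ?thesis
      using a unfolding cubic_kernel_def
      by (subst ennreal_mult'[symmetric])
         (auto simp: indicator_def zero_less_mult_iff power_mult_distrib mult.commute a_def
               intro!: arg_cong[where f = ennreal])
  qed
  have "cubic_constant = ennreal a * (\<integral>\<^sup>+z. cubic_kernel (a * z) 1 \<partial>lborel)"
    unfolding cubic_constant_def
    using a by (subst nn_integral_real_affine[where c = a and t = 0]) auto
  then have "cubic_constant * ennreal (a ^ 3)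
      = (ennreal a * ennreal (a ^ 3)) * (\<integral>\<^sup>+z. cubic_kernel (a * z) 1 \<partial>lborel)"
    by (metis mult.assoc mult.commute)
  also have "ennreal a * ennreal (a ^ 3) = ennreal (a ^ 4)"
    using a by (subst ennreal_mult[symmetric]) (simp_all add: eval_nat_numeral)
  also have "\<dots> * (\<integral>\<^sup>+z. cubic_kernel (a * z) 1 \<partial>lborel)
      = (\<integral>\<^sup>+z. ennreal (a ^ 4) * cubic_kernel (a * z) 1 \<partial>lborel)"
    by (subst nn_integral_cmult) simp_all
  also have "\<dots> = (\<integral>\<^sup>+z. cubic_kernel z x \<partial>lborel)"
    by (simp add: scale)
  finally show ?thesis
    by (simp add: a_def)
qed

text \<open>Both sides may be infinite. Sigma-finiteness covers a probability law as well as a Levy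
  measure of infinite mass.\<close>

lemma nn_integral_abs_cubed:
  fixes M :: "real measure"
  assumes "sigma_finite_measure M" and [measurable_cong]: "sets M = sets borel"
  shows "(\<integral>\<^sup>+z. \<integral>\<^sup>+x. cubic_kernel z x \<partial>M \<partial>lborel) = cubic_constant * (\<integral>\<^sup>+x. ennreal (\<bar>x\<bar> ^ 3) \<partial>M)"
proof -
  interpret sigma_finite_measure M by fact
  interpret pair_sigma_finite M lborel ..
  have "(\<integral>\<^sup>+z. \<integral>\<^sup>+x. cubic_kernel z x \<partial>M \<partial>lborel) = (\<integral>\<^sup>+x. \<integral>\<^sup>+z. cubic_kernel z x \<partial>lborel \<partial>M)"
    by (rule Fubini') measurable
  then show ?thesis
    by (simp add: nn_integral_cubic_kernel nn_integral_cmult)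
qed

section \<open>Exponents of Levy measures with finite first and third moment\<close>

lemma cmod_iexp_minus_one: "cmod (iexp u - 1) \<le> \<bar>u\<bar>"
  using iexp_approx1[of u 0] by simp

text \<open>The first moment makes the integral of \<open>iexp (z * x) - 1\<close> converge without
  a truncation function, even if \<open>F\<close> has infinite mass near 0; the third moment is the
  one that enters the Berry--Esseen bound.\<close>

locale cubic_levy_measure = sigma_finite_measure F for F :: "real measure" +
  assumes sets_F [simp, measurable_cong]: "sets F = sets borel"
    and integrable_id: "integrable F (\<lambda>x. x)"
    and integrable_abs_cubed: "integrable F (\<lambda>x. \<bar>x\<bar> ^ 3)"
begin

text \<open>Compensating by the full linear term makes this the exponent of the centered law, so
  that the mean drops out of all later estimates.\<close>

definition psi :: "real \<Rightarrow> complex" where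
  "psi z = (CLINT x|F. iexp (z * x) - 1 - \<i> * (z * x))"

definition abs_mean :: real where "abs_mean = (LINT x|F. \<bar>x\<bar>)"
definition kappa2 :: real where "kappa2 = (LINT x|F. x\<^sup>2)"
definition kappa3 :: real where "kappa3 = (LINT x|F. \<bar>x\<bar> ^ 3)"

lemma integrable_square: "integrable F (\<lambda>x. x\<^sup>2)"
proof (rule Bochner_Integration.integrable_bound)
  show "integrable F (\<lambda>x. \<bar>x\<bar> + \<bar>x\<bar> ^ 3)"
    using integrable_id integrable_abs_cubed by simp
  have "x\<^sup>2 \<le> \<bar>x\<bar> + \<bar>x\<bar> ^ 3" for x :: real
  proof -
    have "0 \<le> \<bar>x\<bar> * ((\<bar>x\<bar> - 1)\<^sup>2 + \<bar>x\<bar>)"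
      by simp
    also have "\<dots> = \<bar>x\<bar> + \<bar>x\<bar> ^ 3 - \<bar>x\<bar>\<^sup>2"
      by (simp add: power2_eq_square power3_eq_cube algebra_simps)
    finally show ?thesis by simp
  qed
  then show "AE x in F. norm (x\<^sup>2) \<le> norm (\<bar>x\<bar> + \<bar>x\<bar> ^ 3)"
    by (intro always_eventually allI) (simp add: order_trans[OF _ abs_ge_self])
qed measurable

lemma kappa_nonneg: "0 \<le> abs_mean" "0 \<le> kappa2" "0 \<le> kappa3"
  unfolding abs_mean_def kappa2_def kappa3_def by simp_all

lemma integrable_iexp_minus_one: "integrable F (\<lambda>x. iexp (z * x) - 1)"
proof (rule Bochner_Integration.integrable_bound)
  show "integrable F (\<lambda>x. \<bar>z\<bar> * \<bar>x\<bar>)"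
    using integrable_id by simp
  show "AE x in F. norm (iexp (z * x) - 1) \<le> norm (\<bar>z\<bar> * \<bar>x\<bar>)"
    using cmod_iexp_minus_one[of "z * x" for x] by (simp add: abs_mult)
qed measurable

lemma integrable_linear: "integrable F (\<lambda>x. \<i> * complex_of_real (z * x))"
  using integrable_id by simp

lemma integrable_compensated: "integrable F (\<lambda>x. iexp (z * x) - 1 - \<i> * complex_of_real (z * x))"
  by (rule Bochner_Integration.integrable_diff[OF integrable_iexp_minus_one integrable_linear])

lemma integral_iexp_minus_one: "(CLINT x|F. iexp (z * x) - 1) = psi z + \<i> * (z * (LINT x|F. x))"
proof -
  have "psi z = (CLINT x|F. iexp (z * x) - 1) - (CLINT x|F. \<i> * complex_of_real (z * x))"
    unfolding psi_def by (rule Bochner_Integration.integral_diff[OF integrable_iexp_minus_one integrable_linear])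
  also have "(CLINT x|F. \<i> * complex_of_real (z * x)) = \<i> * (z * (LINT x|F. x))"
    by simp
  finally show ?thesis by simp
qed

text \<open>Continuity in \<open>z\<close> is what selects the correct \<open>n\<close>-th root of
  the characteristic function in \<open>char_eq_exp\<close>. A convergent sequence of frequencies is
  bounded, which supplies the majorant.\<close>

lemma continuous_integral_iexp_minus_one: "continuous_on A (\<lambda>z. CLINT x|F. iexp (z * x) - 1)"
proof -
  have "isCont (\<lambda>z. CLINT x|F. iexp (z * x) - 1) t" for t
    unfolding continuous_at_sequentially
  proof safe
    fix X :: "nat \<Rightarrow> real" assume X: "X \<longlonglongrightarrow> t"
    then have "bounded (range X)"
      by (rule convergent_imp_bounded)
    then obtain B where B: "\<And>n. \<bar>X n\<bar> \<le> B"
      by (auto simp: bounded_iff)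
    show "((\<lambda>z. CLINT x|F. iexp (z * x) - 1) \<circ> X) \<longlonglongrightarrow> (CLINT x|F. iexp (t * x) - 1)"
      unfolding comp_def
    proof (rule integral_dominated_convergence[where w = "\<lambda>x. B * \<bar>x\<bar>"])
      show "AE x in F. norm (iexp (X n * x) - 1) \<le> B * \<bar>x\<bar>" for n
        by (intro always_eventually allI order_trans[OF cmod_iexp_minus_one])
           (simp add: abs_mult mult_right_mono[OF B])
    qed (use integrable_id in \<open>auto intro!: tendsto_intros X\<close>)
  qed
  then show ?thesis
    by (simp add: continuous_at_imp_continuous_on)
qed

section \<open>Growth and expansion of the exponent\<close>

lemma cmod_psi_le_linear: "cmod (psi z) \<le> 2 * abs_mean * \<bar>z\<bar>"
proof -
  have "cmod (psi z) \<le> (LINT x|F. 2 * \<bar>z\<bar> * \<bar>x\<bar>)"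
    unfolding psi_def
  proof (rule Bochner_Integration.integral_norm_bound_integral[OF integrable_compensated])
    show "cmod (iexp (z * x) - 1 - \<i> * (z * x)) \<le> 2 * \<bar>z\<bar> * \<bar>x\<bar>" for x
      using iexp_approx2[of "z * x" 1] by (simp add: abs_mult diff_diff_eq)
  qed (use integrable_id in simp)
  then show ?thesis
    by (simp add: abs_mean_def mult_ac)
qed

text \<open>Effective near 0, whereas the linear bound governs large \<open>z\<close>;
  \<open>cmod_psi_square_le\<close> combines the two so that
  \<open>(cmod (psi z))\<^sup>2 / z ^ 4\<close> becomes integrable.\<close>

lemma cmod_psi_le_quadratic: "cmod (psi z) \<le> kappa2 * z\<^sup>2 / 2"
proof -
  have "cmod (psi z) \<le> (LINT x|F. z\<^sup>2 / 2 * x\<^sup>2)"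
    unfolding psi_def
  proof (rule Bochner_Integration.integral_norm_bound_integral[OF integrable_compensated])
    show "cmod (iexp (z * x) - 1 - \<i> * (z * x)) \<le> z\<^sup>2 / 2 * x\<^sup>2" for x
      using iexp_approx1[of "z * x" 1] by (simp add: abs_mult diff_diff_eq power2_eq_square mult_ac)
  qed (use integrable_square in simp)
  then show ?thesis
    by (simp add: kappa2_def mult_ac)
qed

lemma cmod_psi_cubic: "cmod (psi z + kappa2 * z\<^sup>2 / 2) \<le> kappa3 * \<bar>z\<bar> ^ 3 / 6"
proof -
  have int: "integrable F (\<lambda>x. complex_of_real (z\<^sup>2 / 2 * x\<^sup>2))"
    using integrable_square by (intro integrable_of_real) simp
  have "psi z + kappa2 * z\<^sup>2 / 2
      = (CLINT x|F. (iexp (z * x) - 1 - \<i> * (z * x)) + complex_of_real (z\<^sup>2 / 2 * x\<^sup>2))"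
    unfolding psi_def kappa2_def
    by (subst Bochner_Integration.integral_add[OF integrable_compensated int],
        subst integral_complex_of_real) simp
  also have "cmod \<dots> \<le> (LINT x|F. \<bar>z\<bar> ^ 3 / 6 * \<bar>x\<bar> ^ 3)"
  proof (rule Bochner_Integration.integral_norm_bound_integral)
    show "cmod ((iexp (z * x) - 1 - \<i> * (z * x)) + complex_of_real (z\<^sup>2 / 2 * x\<^sup>2))
        \<le> \<bar>z\<bar> ^ 3 / 6 * \<bar>x\<bar> ^ 3" for x
    proof -
      have "(iexp (z * x) - 1 - \<i> * (z * x)) + complex_of_real (z\<^sup>2 / 2 * x\<^sup>2)
          = iexp (z * x) - (\<Sum>k\<le>2. (\<i> * complex_of_real (z * x)) ^ k / fact k)"
        by (simp add: numeral_2_eq_2 power2_eq_square algebra_simps)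
      moreover have "cmod (iexp (z * x) - (\<Sum>k\<le>2. (\<i> * complex_of_real (z * x)) ^ k / fact k))
          \<le> \<bar>z * x\<bar> ^ Suc 2 / fact (Suc 2)"
        by (rule iexp_approx1)
      ultimately have "cmod ((iexp (z * x) - 1 - \<i> * (z * x)) + complex_of_real (z\<^sup>2 / 2 * x\<^sup>2))
          \<le> \<bar>z * x\<bar> ^ Suc 2 / fact (Suc 2)"
        by (simp only:)
      also have "\<dots> = \<bar>z\<bar> ^ 3 / 6 * \<bar>x\<bar> ^ 3"
        by (simp add: fact_numeral abs_mult power_mult_distrib)
      finally show ?thesis .
    qed
  qed (use integrable_compensated int integrable_abs_cubed in \<open>auto simp del: of_real_mult\<close>)
  also have "\<dots> = kappa3 * \<bar>z\<bar> ^ 3 / 6"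
    by (simp add: kappa3_def)
  finally show ?thesis .
qed

section \<open>Real part of the exponent and the cubic kernel\<close>

lemma integrable_cos_minus_one: "integrable F (\<lambda>x. cos (z * x) - 1)"
  using integrable_Re[OF integrable_iexp_minus_one[of z]] by (simp add: Re_exp)

lemma Re_psi: "Re (psi z) = (LINT x|F. cos (z * x) - 1)"
proof -
  have "Re (psi z) = (LINT x|F. Re (iexp (z * x) - 1 - \<i> * (z * x)))"
    unfolding psi_def by (rule integral_Re[OF integrable_compensated, symmetric])
  then show ?thesis
    by (simp add: Re_exp)
qed

lemma Re_psi_nonpos: "Re (psi z) \<le> 0"
proof -
  have "0 \<le> (LINT x|F. - (cos (z * x) - 1))"
    by (rule Bochner_Integration.integral_nonneg) simp
  then show ?thesis
    unfolding Re_psi Bochner_Integration.integral_minus by simp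
qed

lemma nn_integral_cubic_kernel_psi:
  "(\<integral>\<^sup>+x. cubic_kernel z x \<partial>F) = ennreal (indicator {0<..} z * (Re (psi z) + z\<^sup>2 * kappa2 / 2) / z ^ 4)"
proof -
  let ?h = "\<lambda>x. indicator {0<..} z * (cos (z * x) - 1 + z\<^sup>2 / 2 * x\<^sup>2) / z ^ 4"
  have "(\<integral>\<^sup>+x. cubic_kernel z x \<partial>F) = (\<integral>\<^sup>+x. ennreal (?h x) \<partial>F)"
    by (simp add: cubic_kernel_def power_mult_distrib)
  also have "\<dots> = ennreal (LINT x|F. ?h x)"
  proof (rule nn_integral_eq_integral)
    show "integrable F ?h"
      by (intro integrable_divide integrable_mult_right Bochner_Integration.integrable_add
          integrable_cos_minus_one integrable_square)
    show "AE x in F. 0 \<le> ?h x"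
      using cos_minus_quadratic_nonneg[of "z * x" for x]
      by (intro always_eventually allI divide_nonneg_nonneg mult_nonneg_nonneg)
         (simp_all add: power_mult_distrib)
  qed
  also have "(LINT x|F. ?h x) = indicator {0<..} z * (Re (psi z) + z\<^sup>2 * kappa2 / 2) / z ^ 4"
    using integrable_cos_minus_one[of z] integrable_square
    by (simp add: Re_psi kappa2_def del: Bochner_Integration.integral_diff)
  finally show ?thesis .
qed

end

section \<open>Moments of infinitely divisible laws\<close>

text \<open>Imaginary and real part, divided by \<open>z\<close> and \<open>z\<^sup>2\<close>, are
  at most \<open>D * z\<^sup>2\<close> and \<open>D * z\<close>; let \<open>z\<close> tend to 0. In
  the application \<open>a\<close> is the mean and \<open>b\<close> half the discrepancy of the
  second moments.\<close>

lemma linear_coefficients_zero_if_cubic: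
  fixes a b D :: real
  assumes "\<And>z. 0 < z \<Longrightarrow> z \<le> 1 \<Longrightarrow> cmod (\<i> * (z * a) + z\<^sup>2 * b) \<le> D * z ^ 3"
  shows "a = 0" "b = 0"
proof -
  have ev: "eventually (\<lambda>z. 0 < z \<and> z \<le> 1) (at_right (0::real))"
    by (auto simp: eventually_at_right[of 0 1] intro!: exI[of _ 1])
  have "eventually (\<lambda>z. \<bar>a\<bar> \<le> D * z\<^sup>2) (at_right 0)"
    using ev
  proof eventually_elim
    case (elim z)
    have "\<bar>z * a\<bar> \<le> D * z ^ 3"
      using order_trans[OF abs_Im_le_cmod assms] elim by simp
    then have "z * \<bar>a\<bar> \<le> z * (D * z\<^sup>2)"
      using elim by (simp add: abs_mult power2_eq_square power3_eq_cube mult_ac)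
    then show ?case
      using elim by simp
  qed
  moreover have "((\<lambda>z. D * z\<^sup>2) \<longlongrightarrow> D * 0\<^sup>2) (at_right 0)"
    by (intro tendsto_intros)
  ultimately have "\<bar>a\<bar> \<le> D * 0\<^sup>2"
    by (intro tendsto_le[OF _ _ tendsto_const]) simp_all
  then show "a = 0" by simp
  have "eventually (\<lambda>z. \<bar>b\<bar> \<le> D * z) (at_right 0)"
    using ev
  proof eventually_elim
    case (elim z)
    have "\<bar>z\<^sup>2 * b\<bar> \<le> D * z ^ 3"
      using order_trans[OF abs_Re_le_cmod assms] elim by (simp add: power2_eq_square)
    then have "z\<^sup>2 * \<bar>b\<bar> \<le> z\<^sup>2 * (D * z)"
      using elim by (simp add: abs_mult power2_eq_square power3_eq_cube mult_ac)
    then show ?case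
      using elim by simp
  qed
  moreover have "((\<lambda>z. D * z) \<longlongrightarrow> D * 0) (at_right 0)"
    by (intro tendsto_intros)
  ultimately have "\<bar>b\<bar> \<le> D * 0"
    by (intro tendsto_le[OF _ _ tendsto_const]) simp_all
  then show "b = 0" by simp
qed

lemma ennreal_plus_le: "ennreal (a + b) \<le> ennreal a + ennreal b"
  by (auto simp: ennreal_plus_if intro!: ennreal_leI)

context cubic_levy_measure
begin

text \<open>The coefficient of \<open>s\<^sup>2\<close> in the third moment estimate: the integral
  over \<open>z\<close> of the bound for \<open>(cmod (psi z))\<^sup>2 / z ^ 4\<close>, divided by
  \<open>cubic_constant\<close>. It is the same for all \<open>s\<close>, which permits the limit of
  short times.\<close>

definition remainder_const :: real where
  "remainder_const = enn2real (ennreal (kappa2\<^sup>2 / 4 + 4 * abs_mean\<^sup>2)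
     * (\<integral>\<^sup>+z. ennreal (indicator {0<..} z / (1 + z\<^sup>2)) \<partial>lborel)) / enn2real cubic_constant"

lemma cmod_psi_square_le:
  "(cmod (psi z))\<^sup>2 * (1 + z\<^sup>2) \<le> (kappa2\<^sup>2 / 4 + 4 * abs_mean\<^sup>2) * z ^ 4"
proof -
  have "(cmod (psi z))\<^sup>2 \<le> (kappa2 * z\<^sup>2 / 2)\<^sup>2" "(cmod (psi z))\<^sup>2 \<le> (2 * abs_mean * \<bar>z\<bar>)\<^sup>2"
    using cmod_psi_le_quadratic cmod_psi_le_linear by (auto intro!: power_mono)
  moreover have "(kappa2 * z\<^sup>2 / 2)\<^sup>2 + (2 * abs_mean * \<bar>z\<bar>)\<^sup>2 * z\<^sup>2
      = (kappa2\<^sup>2 / 4 + 4 * abs_mean\<^sup>2) * z ^ 4"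
    by (simp add: power2_eq_square power4_eq_xxxx algebra_simps)
  ultimately show ?thesis
    using mult_right_mono[of "(cmod (psi z))\<^sup>2" "(2 * abs_mean * \<bar>z\<bar>)\<^sup>2" "z\<^sup>2"]
    by (simp add: distrib_left)
qed

section \<open>Laws whose exponent is a multiple of \<open>psi\<close>\<close>

context
  fixes \<nu> :: "real measure" and s :: real
  assumes law: "real_distribution \<nu>" and s: "0 \<le> s"
    and char_law: "\<And>z. char \<nu> z = exp (s * psi z)"
begin

interpretation nu: real_distribution \<nu>
  by (rule law)

lemma Re_exponent_nonpos: "Re (s * psi z) \<le> 0"
  using s Re_psi_nonpos[of z] by (simp add: mult_nonneg_nonpos)

lemma Re_char_law: "Re (char \<nu> z) = (LINT x|\<nu>. cos (z * x))"
proof -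
  have "Re (char \<nu> z) = (LINT x|\<nu>. Re (iexp (z * x)))"
    unfolding char_def by (intro integral_Re[symmetric] nu.integrable_iexp) auto
  then show ?thesis
    by (simp add: Re_exp)
qed

lemma integrable_cos_law: "integrable \<nu> (\<lambda>x. cos (z * x))"
  by (rule nu.integrable_const_bound[of _ 1]) auto

text \<open>No moment of \<open>\<nu>\<close> is assumed: \<open>cmod_psi_le_quadratic\<close>
  bounds the second difference quotients of \<open>char \<nu>\<close> at 0, and Fatou's lemma
  carries the bound over to the second moment.\<close>

lemma nn_second_moment_le: "(\<integral>\<^sup>+x. ennreal (x\<^sup>2) \<partial>\<nu>) \<le> ennreal (s * kappa2)"
proof -
  \<comment> \<open>With step \<open>h = 1 / real (Suc n)\<close> this is
    \<open>2 * (1 - cos (h * x)) / h\<^sup>2\<close>; up to sign, its integral is the symmetric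
    second difference quotient of \<open>char \<nu>\<close> at 0.\<close>
  define u where "u n x = 2 * (real (Suc n))\<^sup>2 * (1 - cos (1 / real (Suc n) * x))" for n and x :: real
  have [measurable]: "u n \<in> borel_measurable borel" for n
    unfolding u_def by measurable
  have lim: "(\<lambda>n. u n x) \<longlonglongrightarrow> x\<^sup>2" for x
  proof (rule tendsto_sandwich)
    have eq: "u n x = x\<^sup>2 - 2 * (real (Suc n))\<^sup>2 * (cos (x / real (Suc n)) - 1 + (x / real (Suc n))\<^sup>2 / 2)" for n
      by (simp add: u_def field_simps)
    show "\<forall>\<^sub>F n in sequentially. u n x \<le> x\<^sup>2"
      unfolding eq using cos_minus_quadratic_nonneg by (intro always_eventually allI) simp
    show "\<forall>\<^sub>F n in sequentially. x\<^sup>2 - 2 * x ^ 4 * (1 / real (Suc n))\<^sup>2 \<le> u n x"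
    proof (intro always_eventually allI)
      fix n
      let ?v = "x / real (Suc n)"
      have "(cos ?v - 1 + ?v\<^sup>2 / 2) * 1 \<le> (cos ?v - 1 + ?v\<^sup>2 / 2) * (1 + ?v\<^sup>2)"
        by (intro mult_left_mono cos_minus_quadratic_nonneg) simp
      then have "cos ?v - 1 + ?v\<^sup>2 / 2 \<le> ?v ^ 4"
        using cos_minus_quadratic_le[of ?v] by simp
      then have "2 * (real (Suc n))\<^sup>2 * (cos ?v - 1 + ?v\<^sup>2 / 2) \<le> 2 * (real (Suc n))\<^sup>2 * ?v ^ 4"
        by (intro mult_left_mono) simp_all
      also have "\<dots> = 2 * x ^ 4 * (1 / real (Suc n))\<^sup>2"
        by (simp add: power_divide power2_eq_square power4_eq_xxxx del: of_nat_Suc)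
      finally show "x\<^sup>2 - 2 * x ^ 4 * (1 / real (Suc n))\<^sup>2 \<le> u n x"
        unfolding eq by linarith
    qed
    have "(\<lambda>n. x\<^sup>2 - 2 * x ^ 4 * (1 / real (Suc n))\<^sup>2) \<longlonglongrightarrow> x\<^sup>2 - 2 * x ^ 4 * 0\<^sup>2"
      by (intro tendsto_intros LIMSEQ_Suc lim_1_over_n)
    then show "(\<lambda>n. x\<^sup>2 - 2 * x ^ 4 * (1 / real (Suc n))\<^sup>2) \<longlonglongrightarrow> x\<^sup>2"
      by simp
  qed simp
  have bound: "(\<integral>\<^sup>+x. ennreal (u n x) \<partial>\<nu>) \<le> ennreal (s * kappa2)" for n
  proof -
    let ?h = "1 / real (Suc n)"
    have int: "integrable \<nu> (u n)"
      unfolding u_def using integrable_cos_law[of ?h] by simp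
    have "1 - Re (char \<nu> ?h) \<le> cmod (exp (s * psi ?h) - 1)"
      using abs_Re_le_cmod[of "exp (s * psi ?h) - 1"] by (simp add: char_law)
    also have "\<dots> \<le> cmod (s * psi ?h)"
      by (rule cmod_exp_minus_one_le[OF Re_exponent_nonpos])
    also have "\<dots> \<le> s * (kappa2 * ?h\<^sup>2 / 2)"
      using mult_left_mono[OF cmod_psi_le_quadratic[of ?h] s] s by (simp add: norm_mult)
    finally have le: "2 * (real (Suc n))\<^sup>2 * (1 - Re (char \<nu> ?h))
        \<le> 2 * (real (Suc n))\<^sup>2 * (s * (kappa2 * ?h\<^sup>2 / 2))"
      by (intro mult_left_mono) simp_all
    have "(\<integral>\<^sup>+x. ennreal (u n x) \<partial>\<nu>) = ennreal (LINT x|\<nu>. u n x)"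
      by (rule nn_integral_eq_integral[OF int]) (simp add: u_def)
    also have "(LINT x|\<nu>. u n x) = 2 * (real (Suc n))\<^sup>2 * (1 - Re (char \<nu> ?h))"
      unfolding u_def Re_char_law using integrable_cos_law[of ?h]
      by (simp add: nu.prob_space[simplified])
    also have "\<dots> \<le> s * kappa2"
      using le by (simp add: power_divide del: of_nat_Suc)
    finally show ?thesis
      by (simp add: ennreal_leI)
  qed
  have "(\<integral>\<^sup>+x. ennreal (x\<^sup>2) \<partial>\<nu>) = (\<integral>\<^sup>+x. liminf (\<lambda>n. ennreal (u n x)) \<partial>\<nu>)"
    by (intro nn_integral_cong lim_imp_Liminf[symmetric] tendsto_ennrealI lim) simp
  also have "\<dots> \<le> liminf (\<lambda>n. \<integral>\<^sup>+x. ennreal (u n x) \<partial>\<nu>)"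
    by (rule nn_integral_liminf) measurable
  also have "\<dots> \<le> ennreal (s * kappa2)"
    using Liminf_mono[of "\<lambda>n. \<integral>\<^sup>+x. ennreal (u n x) \<partial>\<nu>" "\<lambda>_. ennreal (s * kappa2)" sequentially] bound
    by (simp add: Liminf_const)
  finally show ?thesis .
qed

lemma integrable_square_law: "integrable \<nu> (\<lambda>x. x\<^sup>2)"
  using nn_second_moment_le
  by (intro integrableI_nonneg) (auto intro: le_less_trans)

lemma second_moment_le: "(LINT x|\<nu>. x\<^sup>2) \<le> s * kappa2"
  using nn_second_moment_le nn_integral_eq_integral[OF integrable_square_law] s kappa_nonneg
  by simp

lemma nn_integral_cubic_kernel_law:
  "(\<integral>\<^sup>+x. cubic_kernel z x \<partial>\<nu>)
    = ennreal (indicator {0<..} z * (Re (char \<nu> z) - 1 + z\<^sup>2 * (LINT x|\<nu>. x\<^sup>2) / 2) / z ^ 4)"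
proof -
  let ?h = "\<lambda>x. indicator {0<..} z * (cos (z * x) - 1 + z\<^sup>2 / 2 * x\<^sup>2) / z ^ 4"
  have "(\<integral>\<^sup>+x. cubic_kernel z x \<partial>\<nu>) = (\<integral>\<^sup>+x. ennreal (?h x) \<partial>\<nu>)"
    by (simp add: cubic_kernel_def power_mult_distrib)
  also have "\<dots> = ennreal (LINT x|\<nu>. ?h x)"
  proof (rule nn_integral_eq_integral)
    show "integrable \<nu> ?h"
      by (intro integrable_divide integrable_mult_right Bochner_Integration.integrable_add
          Bochner_Integration.integrable_diff integrable_cos_law integrable_square_law nu.integrable_const)
    show "AE x in \<nu>. 0 \<le> ?h x"
      using cos_minus_quadratic_nonneg[of "z * x" for x]
      by (intro always_eventually allI divide_nonneg_nonneg mult_nonneg_nonneg)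
         (simp_all add: power_mult_distrib)
  qed
  also have "(LINT x|\<nu>. ?h x) = indicator {0<..} z * (Re (char \<nu> z) - 1 + z\<^sup>2 * (LINT x|\<nu>. x\<^sup>2) / 2) / z ^ 4"
    using integrable_cos_law[of z] integrable_square_law
    by (simp add: Re_char_law nu.prob_space[simplified])
  finally show ?thesis .
qed

text \<open>Replacing \<open>char \<nu> z - 1\<close> by \<open>s * psi z\<close> costs at most
  \<open>(cmod (s * psi z))\<^sup>2\<close>, which \<open>cmod_psi_square_le\<close> turns into a
  multiple of \<open>z ^ 4 / (1 + z\<^sup>2)\<close>.\<close>

lemma cubic_kernel_law_le:
  "(\<integral>\<^sup>+x. cubic_kernel z x \<partial>\<nu>) \<le> ennreal s * (\<integral>\<^sup>+x. cubic_kernel z x \<partial>F)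
     + ennreal (s\<^sup>2) * (ennreal (kappa2\<^sup>2 / 4 + 4 * abs_mean\<^sup>2) * ennreal (indicator {0<..} z / (1 + z\<^sup>2)))"
proof (cases "z > 0")
  case True
  let ?C = "kappa2\<^sup>2 / 4 + 4 * abs_mean\<^sup>2"
  have "Re (char \<nu> z) - 1 - s * Re (psi z) \<le> cmod (exp (s * psi z) - 1 - s * psi z)"
    using complex_Re_le_cmod[of "exp (s * psi z) - 1 - s * psi z"] by (simp add: char_law)
  also have "\<dots> \<le> (cmod (s * psi z))\<^sup>2"
    by (rule cmod_exp_minus_linear_le[OF Re_exponent_nonpos])
  also have "\<dots> = s\<^sup>2 * (cmod (psi z))\<^sup>2"
    by (simp add: norm_mult power_mult_distrib)
  also have "(cmod (psi z))\<^sup>2 \<le> ?C * z ^ 4 / (1 + z\<^sup>2)"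
    using cmod_psi_square_le[of z] by (simp add: pos_le_divide_eq add_pos_nonneg)
  finally have 1: "Re (char \<nu> z) - 1 - s * Re (psi z) \<le> s\<^sup>2 * (?C * z ^ 4 / (1 + z\<^sup>2))"
    by (simp add: mult_left_mono)
  \<comment> \<open>So far only this inequality for the second moment is available; it suffices
    because that moment enters with a plus sign.\<close>
  have "z\<^sup>2 * (LINT x|\<nu>. x\<^sup>2) \<le> z\<^sup>2 * (s * kappa2)"
    by (intro mult_left_mono second_moment_le) simp
  with 1 have "Re (char \<nu> z) - 1 + z\<^sup>2 * (LINT x|\<nu>. x\<^sup>2) / 2
      \<le> s * (Re (psi z) + z\<^sup>2 * kappa2 / 2) + s\<^sup>2 * (?C * z ^ 4 / (1 + z\<^sup>2))"
    by (simp add: algebra_simps)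
  then have "(Re (char \<nu> z) - 1 + z\<^sup>2 * (LINT x|\<nu>. x\<^sup>2) / 2) / z ^ 4
      \<le> (s * (Re (psi z) + z\<^sup>2 * kappa2 / 2) + s\<^sup>2 * (?C * z ^ 4 / (1 + z\<^sup>2))) / z ^ 4"
    by (rule divide_right_mono) simp
  also have "\<dots> = s * ((Re (psi z) + z\<^sup>2 * kappa2 / 2) / z ^ 4) + s\<^sup>2 * (?C * (1 / (1 + z\<^sup>2)))"
  proof -
    have "(s * p + s\<^sup>2 * (q * z ^ 4 / (1 + z\<^sup>2))) / z ^ 4 = s * (p / z ^ 4) + s\<^sup>2 * (q * (1 / (1 + z\<^sup>2)))"
      for p q :: real
      using True by (simp add: add_divide_distrib)
    then show ?thesis .
  qed
  finally have "ennreal ((Re (char \<nu> z) - 1 + z\<^sup>2 * (LINT x|\<nu>. x\<^sup>2) / 2) / z ^ 4)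
      \<le> ennreal (s * ((Re (psi z) + z\<^sup>2 * kappa2 / 2) / z ^ 4) + s\<^sup>2 * (?C * (1 / (1 + z\<^sup>2))))"
    by (rule ennreal_leI)
  also have "\<dots> \<le> ennreal (s * ((Re (psi z) + z\<^sup>2 * kappa2 / 2) / z ^ 4)) + ennreal (s\<^sup>2 * (?C * (1 / (1 + z\<^sup>2))))"
    by (rule ennreal_plus_le)
  also have "\<dots> = ennreal s * ennreal ((Re (psi z) + z\<^sup>2 * kappa2 / 2) / z ^ 4)
      + ennreal (s\<^sup>2) * (ennreal ?C * ennreal (1 / (1 + z\<^sup>2)))"
    using s by (simp only: ennreal_mult' ennreal_mult'' zero_le_power2 zero_le_divide_1_iff
        add_nonneg_nonneg zero_le_one)
  finally show ?thesis
    using True by (simp add: nn_integral_cubic_kernel_law nn_integral_cubic_kernel_psi)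
qed (simp add: cubic_kernel_def)

text \<open>Integrate \<open>cubic_kernel_law_le\<close> over \<open>z\<close>, apply
  \<open>nn_integral_abs_cubed\<close> to both \<open>\<nu>\<close> and \<open>F\<close>, and divide
  by \<open>cubic_constant\<close>.\<close>

lemma abs_third_moment_law:
  "integrable \<nu> (\<lambda>x. \<bar>x\<bar> ^ 3)" (is ?int)
  "(LINT x|\<nu>. \<bar>x\<bar> ^ 3) \<le> s * kappa3 + s\<^sup>2 * remainder_const" (is ?le)
proof -
  let ?J = "\<integral>\<^sup>+z. ennreal (indicator {0<..} z / (1 + z\<^sup>2)) \<partial>lborel"
  let ?C = "kappa2\<^sup>2 / 4 + 4 * abs_mean\<^sup>2"
  obtain k where k: "cubic_constant = ennreal k" "k > 0"
    using cubic_constant_finite cubic_constant_pos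
    by (intro that[of "enn2real cubic_constant"]) (simp_all add: enn2real_positive_iff)
  obtain j where j: "ennreal ?C * ?J = ennreal j" "j \<ge> 0"
    using nn_integral_cauchy_kernel by (cases "ennreal ?C * ?J") (auto simp: ennreal_mult_eq_top_iff)
  have D: "remainder_const = j / k"
    using j k by (simp add: remainder_const_def)
  let ?A = "\<integral>\<^sup>+x. ennreal (\<bar>x\<bar> ^ 3) \<partial>\<nu>"
  have "cubic_constant * ?A = (\<integral>\<^sup>+z. \<integral>\<^sup>+x. cubic_kernel z x \<partial>\<nu> \<partial>lborel)"
    using nn_integral_abs_cubed[OF nu.sigma_finite_measure_axioms] by simp
  also have "\<dots> \<le> (\<integral>\<^sup>+z. ennreal s * (\<integral>\<^sup>+x. cubic_kernel z x \<partial>F)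
     + ennreal (s\<^sup>2) * (ennreal ?C * ennreal (indicator {0<..} z / (1 + z\<^sup>2))) \<partial>lborel)"
    by (intro nn_integral_mono cubic_kernel_law_le)
  also have "\<dots> = ennreal s * (\<integral>\<^sup>+z. \<integral>\<^sup>+x. cubic_kernel z x \<partial>F \<partial>lborel) + ennreal (s\<^sup>2) * (ennreal ?C * ?J)"
    by (simp add: nn_integral_add nn_integral_cmult)
  also have "(\<integral>\<^sup>+z. \<integral>\<^sup>+x. cubic_kernel z x \<partial>F \<partial>lborel) = cubic_constant * (\<integral>\<^sup>+x. ennreal (\<bar>x\<bar> ^ 3) \<partial>F)"
    by (rule nn_integral_abs_cubed[OF sigma_finite_measure_axioms sets_F])
  also have "(\<integral>\<^sup>+x. ennreal (\<bar>x\<bar> ^ 3) \<partial>F) = ennreal kappa3"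
    unfolding kappa3_def by (rule nn_integral_eq_integral[OF integrable_abs_cubed]) simp
  also have "ennreal s * (cubic_constant * ennreal kappa3) + ennreal (s\<^sup>2) * (ennreal ?C * ?J)
      = ennreal (s * (k * kappa3) + s\<^sup>2 * j)"
    using s k j kappa_nonneg by (simp add: ennreal_mult ennreal_plus)
  finally have le: "ennreal k * ?A \<le> ennreal (s * (k * kappa3) + s\<^sup>2 * j)"
    by (simp add: k)
  \<comment> \<open>The finite right-hand side excludes an infinite moment; integrability is thus a
    conclusion of the estimate.\<close>
  have "?A \<noteq> \<infinity>"
    using le k cubic_constant_pos by (auto simp: ennreal_mult_top top_unique split: if_splits)
  then show ?int
    by (intro integrableI_nonneg) (auto simp: less_top)
  then have "?A = ennreal (LINT x|\<nu>. \<bar>x\<bar> ^ 3)"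
    by (rule nn_integral_eq_integral) simp
  with le have "ennreal (k * (LINT x|\<nu>. \<bar>x\<bar> ^ 3)) \<le> ennreal (s * (k * kappa3) + s\<^sup>2 * j)"
    using k by (simp add: ennreal_mult)
  then have "k * (LINT x|\<nu>. \<bar>x\<bar> ^ 3) \<le> s * (k * kappa3) + s\<^sup>2 * j"
    using s k j kappa_nonneg by (subst (asm) ennreal_le_iff) auto
  then have "(LINT x|\<nu>. \<bar>x\<bar> ^ 3) \<le> (s * (k * kappa3) + s\<^sup>2 * j) / k"
    using k by (simp add: pos_le_divide_eq mult.commute)
  also have "\<dots> = s * kappa3 + s\<^sup>2 * remainder_const"
    using k by (simp add: D field_simps)
  finally show ?le .
qed

lemma integrable_id_law: "integrable \<nu> (\<lambda>x. x)"
proof (rule Bochner_Integration.integrable_bound)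
  show "integrable \<nu> (\<lambda>x. 1 + x\<^sup>2)"
    using integrable_square_law by simp
  show "AE x in \<nu>. norm x \<le> norm (1 + x\<^sup>2)"
  proof (intro always_eventually allI)
    fix x :: real
    show "norm x \<le> norm (1 + x\<^sup>2)"
      using power2_diff[of 1 "\<bar>x\<bar>"] zero_le_power2[of "1 - \<bar>x\<bar>"]
      by (simp add: abs_of_pos add_pos_nonneg)
  qed
qed simp

text \<open>Both \<open>char \<nu> z\<close> and \<open>exp (s * psi z)\<close> have second-order
  expansions with cubic error, and comparing coefficients gives the moments. Equality of the
  variance is essential, since it is the normalisation in the Berry--Esseen theorem.\<close>

lemma moments_law: "(LINT x|\<nu>. x) = 0" "(LINT x|\<nu>. x\<^sup>2) = s * kappa2"
proof -
  let ?m1 = "LINT x|\<nu>. x" and ?m2 = "LINT x|\<nu>. x\<^sup>2" and ?m3 = "LINT x|\<nu>. \<bar>x\<bar> ^ 3"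
  \<comment> \<open>Three errors in order: the Taylor remainder of \<open>char \<nu>\<close>, the
    cubic remainder of \<open>psi\<close>, and the linearisation of \<open>exp\<close>. The last one
    is of order \<open>z ^ 4\<close> and is absorbed by \<open>z \<le> 1\<close>.\<close>
  define D where "D = ?m3 / 6 + s * kappa3 / 6 + (s * kappa2 / 2)\<^sup>2"
  have "cmod (\<i> * (z * ?m1) + z\<^sup>2 * ((s * kappa2 - ?m2) / 2)) \<le> D * z ^ 3" if z: "0 < z" "z \<le> 1" for z
  proof -
    have "cmod (char \<nu> z - (\<Sum>k\<le>2. (\<i> * z) ^ k / fact k * (LINT x|\<nu>. x ^ k)))
        \<le> \<bar>z\<bar>\<^sup>2 / fact (Suc 2) * (LINT x|\<nu>. min (2 * \<bar>x\<bar>\<^sup>2 * Suc 2) (\<bar>z\<bar> * \<bar>x\<bar> ^ Suc 2))"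
    proof (rule nu.char_approx2)
      show "integrable \<nu> (\<lambda>x. x ^ k)" if "k \<le> 2" for k
        using that integrable_id_law integrable_square_law
        by (auto simp: le_Suc_eq numeral_2_eq_2)
    qed
    also have "(\<Sum>k\<le>2. (\<i> * z) ^ k / fact k * (LINT x|\<nu>. x ^ k)) = 1 + \<i> * (z * ?m1) - z\<^sup>2 * ?m2 / 2"
    proof -
      have "{..2::nat} = {0, 1, 2}" by auto
      then show ?thesis
        by (simp add: nu.prob_space[simplified] power_mult_distrib)
    qed
    finally have 0: "cmod (char \<nu> z - (1 + \<i> * (z * ?m1) - z\<^sup>2 * ?m2 / 2))
        \<le> \<bar>z\<bar>\<^sup>2 / fact (Suc 2) * (LINT x|\<nu>. min (2 * \<bar>x\<bar>\<^sup>2 * Suc 2) (\<bar>z\<bar> * \<bar>x\<bar> ^ Suc 2))" .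
    have "(LINT x|\<nu>. min (2 * \<bar>x\<bar>\<^sup>2 * Suc 2) (\<bar>z\<bar> * \<bar>x\<bar> ^ Suc 2)) \<le> (LINT x|\<nu>. \<bar>z\<bar> * \<bar>x\<bar> ^ Suc 2)"
    proof (rule integral_mono)
      show i: "integrable \<nu> (\<lambda>x. \<bar>z\<bar> * \<bar>x\<bar> ^ Suc 2)"
        using abs_third_moment_law(1) by (simp add: numeral_3_eq_3 numeral_2_eq_2)
      show "integrable \<nu> (\<lambda>x. min (2 * \<bar>x\<bar>\<^sup>2 * Suc 2) (\<bar>z\<bar> * \<bar>x\<bar> ^ Suc 2))"
        by (rule Bochner_Integration.integrable_bound[OF i]) (auto simp: min_def)
    qed auto
    also have "\<dots> = z * ?m3"
      using z by (simp add: numeral_3_eq_3 numeral_2_eq_2)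
    finally have "cmod (char \<nu> z - (1 + \<i> * (z * ?m1) - z\<^sup>2 * ?m2 / 2)) \<le> \<bar>z\<bar>\<^sup>2 / fact (Suc 2) * (z * ?m3)"
      by (intro order_trans[OF 0] mult_left_mono) simp_all
    also have "\<dots> = ?m3 / 6 * z ^ 3"
      by (simp add: fact_numeral power2_eq_square power3_eq_cube)
    finally have 1: "cmod (char \<nu> z - (1 + \<i> * (z * ?m1) - z\<^sup>2 * ?m2 / 2)) \<le> ?m3 / 6 * z ^ 3" .
    have "cmod (char \<nu> z - 1 - s * psi z) \<le> (cmod (s * psi z))\<^sup>2"
      unfolding char_law by (rule cmod_exp_minus_linear_le[OF Re_exponent_nonpos])
    also have "\<dots> \<le> (s * (kappa2 * z\<^sup>2 / 2))\<^sup>2"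
      using s mult_left_mono[OF cmod_psi_le_quadratic[of z] s] by (intro power_mono) (simp_all add: norm_mult)
    also have "\<dots> = (s * kappa2 / 2)\<^sup>2 * z ^ 4"
      by (simp add: power2_eq_square power4_eq_xxxx)
    also have "\<dots> \<le> (s * kappa2 / 2)\<^sup>2 * z ^ 3"
      using z by (intro mult_left_mono power_decreasing) auto
    finally have 2: "cmod (char \<nu> z - 1 - s * psi z) \<le> (s * kappa2 / 2)\<^sup>2 * z ^ 3" .
    have 3: "cmod (s * psi z + s * (kappa2 * z\<^sup>2 / 2)) \<le> s * kappa3 / 6 * z ^ 3"
    proof -
      have "s * psi z + s * (kappa2 * z\<^sup>2 / 2) = s * (psi z + kappa2 * z\<^sup>2 / 2)"
        by (simp add: algebra_simps)
      then show ?thesis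
        using mult_left_mono[OF cmod_psi_cubic[of z] s] s z by (simp add: norm_mult)
    qed
    have "\<i> * (z * ?m1) + z\<^sup>2 * ((s * kappa2 - ?m2) / 2)
        = (char \<nu> z - 1 - s * psi z) + (s * psi z + s * (kappa2 * z\<^sup>2 / 2))
          - (char \<nu> z - (1 + \<i> * (z * ?m1) - z\<^sup>2 * ?m2 / 2))"
      by (simp add: field_simps)
    also have "cmod \<dots> \<le> (s * kappa2 / 2)\<^sup>2 * z ^ 3 + s * kappa3 / 6 * z ^ 3 + ?m3 / 6 * z ^ 3"
      using 1 2 3 norm_triangle_ineq4 norm_triangle_ineq by (smt (verit))
    also have "\<dots> = D * z ^ 3"
      by (simp add: D_def algebra_simps)
    finally show ?thesis .
  qed
  from linear_coefficients_zero_if_cubic[OF this]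
  show "?m1 = 0" "?m2 = s * kappa2" by simp_all
qed

end

end

section \<open>Levy processes and the Berry--Esseen bound\<close>

lemma (in prob_space) char_distr:
  assumes [measurable]: "random_variable borel f"
  shows "char (distr M borel f) z = (CLINT x|M. iexp (z * f x))"
  unfolding char_def by (subst integral_distr) simp_all

lemma (in indep_increments_process) indep_increments_equidistant:
  assumes "0 < h"
  shows "indep_vars (\<lambda>_. borel) (\<lambda>i \<omega>. X (real (Suc i) * h) \<omega> - X (real i * h) \<omega>) {..<n}"
  using indep_increments[of "\<lambda>i. real i * h" n] assms by simp

text \<open>The value at time \<open>real n * h\<close> telescopes into \<open>n\<close> independent
  increments, each distributed like \<open>X h\<close> by stationarity. As \<open>X 0\<close>
  vanishes only almost surely, the laws are compared by \<open>distr_cong_AE\<close>.\<close>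

lemma (in levy_process) char_multiple:
  assumes h: "0 < h"
  shows "char (distr M borel (X (real n * h))) z = char (distr M borel (X h)) z ^ n"
proof -
  have [measurable]: "random_variable borel (X (real i * h))" for i
    using h by (intro rv) simp
  have "distr M borel (X (real n * h))
      = distr M borel (\<lambda>\<omega>. \<Sum>i<n. X (real (Suc i) * h) \<omega> - X (real i * h) \<omega>)"
  proof (rule distr_cong_AE)
    have "(\<Sum>i<n. X (real (Suc i) * h) \<omega> - X (real i * h) \<omega>) = X (real n * h) \<omega> - X 0 \<omega>" for \<omega>
      using sum_lessThan_telescope[of "\<lambda>i. X (real i * h) \<omega>" n] by simp
    then show "AE \<omega> in M. X (real n * h) \<omega> = (\<Sum>i<n. X (real (Suc i) * h) \<omega> - X (real i * h) \<omega>)"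
      using initial by simp
  qed (simp_all del: of_nat_Suc)
  then have "char (distr M borel (X (real n * h))) z
      = (\<Prod>i<n. char (distr M borel (\<lambda>\<omega>. X (real (Suc i) * h) \<omega> - X (real i * h) \<omega>)) z)"
    by (simp only: char_distr_sum[OF indep_increments_equidistant[OF h]])
  also have "\<dots> = (\<Prod>i<n. char (distr M borel (X h)) z)"
    using h stationary_increments[of "real i * h" h for i]
    by (intro prod.cong refl) (simp add: distrib_right add.commute)
  finally show ?thesis by simp
qed

text \<open>The formula passes from time 1 to the times \<open>1 / real n\<close>, then by
  \<open>char_multiple\<close> to rational times, and finally by right-continuous paths and
  dominated convergence to all times.\<close>

lemma (in levy_process) char_eq_exp:
  fixes \<psi> :: "real \<Rightarrow> complex"
  assumes cont: "continuous_on UNIV \<psi>" and \<psi>0: "\<psi> 0 = 0"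
    and char_1: "\<And>z. char (distr M borel (X 1)) z = exp (\<psi> z)"
    and t: "0 \<le> t"
  shows "char (distr M borel (X t)) z = exp (t * \<psi> z)"
proof -
  have dist: "real_distribution (distr M borel (X s))" if "0 \<le> s" for s
    using rv[OF that] by (rule real_distribution_distr)
  \<comment> \<open>The quotient of the two sides is a continuous function of the frequency with values in the
    \<open>n\<close>-th roots of unity, hence constant.\<close>
  have root: "char (distr M borel (X (1 / real n))) z = exp (\<psi> z / n)" if n: "0 < n" for n z
  proof -
    interpret D: real_distribution "distr M borel (X (1 / real n))"
      by (rule dist) simp
    define r where "r z = char (distr M borel (X (1 / real n))) z / exp (\<psi> z / n)" for z
    have "r constant_on UNIV"
    proof (rule continuous_finite_range_constant)
      have "continuous_on UNIV (char (distr M borel (X (1 / real n))))"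
        by (intro continuous_at_imp_continuous_on ballI D.isCont_char)
      then show "continuous_on UNIV r"
        unfolding r_def by (intro continuous_intros cont) (use n in auto)
      have "r z ^ n = 1" for z
      proof -
        have "char (distr M borel (X (1 / real n))) z ^ n = exp (\<psi> z)"
          using char_multiple[of "1 / real n" n z] n char_1 by simp
        moreover have "exp (\<psi> z / n) ^ n = exp (\<psi> z)"
          using n by (simp flip: exp_of_nat_mult)
        ultimately show ?thesis
          by (simp add: r_def power_divide)
      qed
      then have "range r \<subseteq> {z. z ^ n = 1}" by auto
      then show "finite (range r)"
        using finite_roots_unity[of n] n by (auto intro: finite_subset)
    qed simp
    then obtain a where a: "\<And>z. r z = a"
      by (auto simp: constant_on_def)
    have "r 0 = 1"
      by (simp add: r_def \<psi>0 D.char_zero)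
    then have "r z = 1"
      using a by simp
    then show ?thesis
      by (simp add: r_def)
  qed
  have rational: "char (distr M borel (X (real k / real n))) z = exp ((real k / real n) * \<psi> z)"
    if n: "0 < n" for n k
    using char_multiple[of "1 / real n" k z] root[OF n, of z] n by (simp flip: exp_of_nat_mult)
  \<comment> \<open>The \<open>+ 1\<close> keeps these rational times strictly above
    \<open>t\<close>, as \<open>at_right t\<close> demands, also for \<open>t = 0\<close>.\<close>
  define q where "q n = real (nat \<lfloor>t * real (Suc n)\<rfloor> + 1) / real (Suc n)" for n
  have q: "t < q n" "q n \<le> t + 1 / real (Suc n)" for n
  proof -
    have "0 \<le> t * real (Suc n)" using t by simp
    then have eq: "real (nat \<lfloor>t * real (Suc n)\<rfloor> + 1) = of_int \<lfloor>t * real (Suc n)\<rfloor> + 1"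
      by (subst of_nat_add) (simp add: of_nat_nat del: of_nat_Suc)
    have "t * real (Suc n) < of_int \<lfloor>t * real (Suc n)\<rfloor> + 1"
      "of_int \<lfloor>t * real (Suc n)\<rfloor> + 1 \<le> t * real (Suc n) + 1"
      by linarith+
    then show "t < q n" "q n \<le> t + 1 / real (Suc n)"
      unfolding q_def eq by (simp_all add: field_simps del: of_nat_Suc)
  qed
  have q_lim: "q \<longlonglongrightarrow> t"
  proof (rule tendsto_sandwich[where f = "\<lambda>_. t" and h = "\<lambda>n. t + 1 / real (Suc n)"])
    have "(\<lambda>n. t + 1 / real (Suc n)) \<longlonglongrightarrow> t + 0"
      by (intro tendsto_intros LIMSEQ_Suc lim_1_over_n)
    then show "(\<lambda>n. t + 1 / real (Suc n)) \<longlonglongrightarrow> t" by simp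
    show "\<forall>\<^sub>F n in sequentially. t \<le> q n" "\<forall>\<^sub>F n in sequentially. q n \<le> t + 1 / real (Suc n)"
      using q by (auto intro!: always_eventually less_imp_le)
  qed simp
  then have q_right: "filterlim q (at_right t) sequentially"
    using q by (auto simp: filterlim_at intro!: always_eventually)
  have q_nonneg: "0 \<le> q n" for n
    using t q(1)[of n] by linarith
  have [measurable]: "random_variable borel (X t)" "random_variable borel (X (q n))" for n
    by (rule rv[OF t], rule rv[OF q_nonneg])
  have "(\<lambda>n. char (distr M borel (X (q n))) z) \<longlonglongrightarrow> char (distr M borel (X t)) z"
    unfolding char_distr[OF rv[OF t]] char_distr[OF rv[OF q_nonneg]]
  proof (rule integral_dominated_convergence[where w = "\<lambda>_. 1"])
    show "AE \<omega> in M. (\<lambda>n. iexp (z * X (q n) \<omega>)) \<longlonglongrightarrow> iexp (z * X t \<omega>)"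
      using cadlag_paths
    proof eventually_elim
      case (elim \<omega>)
      then have "((\<lambda>s. X s \<omega>) \<longlongrightarrow> X t \<omega>) (at_right t)"
        using t by (simp add: cadlag_def)
      then have "(\<lambda>n. X (q n) \<omega>) \<longlonglongrightarrow> X t \<omega>"
        using q_right by (rule filterlim_compose)
      then show ?case
        by (intro tendsto_intros)
    qed
  qed auto
  moreover have "(\<lambda>n. char (distr M borel (X (q n))) z) \<longlonglongrightarrow> exp (t * \<psi> z)"
  proof -
    have "char (distr M borel (X (q n))) z = exp (q n * \<psi> z)" for n
      unfolding q_def by (subst rational) simp_all
    then show ?thesis
      by (simp only:) (intro tendsto_intros q_lim)
  qed
  ultimately show ?thesis
    by (rule LIMSEQ_unique)
qed

section \<open>Berry--Esseen bounds for infinitely divisible laws\<close>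

lemma indep_vars_PiM_coordinates:
  fixes \<nu> :: "real measure"
  assumes "real_distribution \<nu>"
  shows "prob_space.indep_vars (PiM UNIV (\<lambda>_::nat. \<nu>)) (\<lambda>_. borel) (\<lambda>j \<omega>. \<omega> j) UNIV"
    and "distr (PiM UNIV (\<lambda>_::nat. \<nu>)) borel (\<lambda>\<omega>. \<omega> j) = \<nu>"
proof -
  interpret nu: real_distribution \<nu> by fact
  let ?P = "PiM UNIV (\<lambda>_::nat. \<nu>)"
  interpret P: prob_space ?P
    by (rule prob_space_PiM) unfold_locales
  have [measurable_cong]: "sets \<nu> = sets borel" by simp
  have comp: "distr ?P borel (\<lambda>\<omega>. \<omega> j) = \<nu>" for j
  proof -
    have "distr ?P borel (\<lambda>\<omega>. \<omega> j) = distr ?P \<nu> (\<lambda>\<omega>. \<omega> j)"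
      by (rule distr_cong) simp_all
    then show ?thesis
      using distr_PiM_component[of UNIV "\<lambda>_. \<nu>" j] nu.prob_space_axioms by simp
  qed
  then show "distr ?P borel (\<lambda>\<omega>. \<omega> j) = \<nu>" .
  have sets: "sets (PiM UNIV (\<lambda>_::nat. borel :: real measure)) = sets ?P"
    by (rule sets_PiM_cong) simp_all
  have "distr ?P (PiM UNIV (\<lambda>_. borel)) (\<lambda>x. x) = distr ?P ?P (\<lambda>x. x)"
    by (rule distr_cong) (simp_all add: sets)
  then show "P.indep_vars (\<lambda>_. borel) (\<lambda>j \<omega>. \<omega> j) UNIV"
    by (subst P.indep_vars_iff_distr_eq_PiM) (simp_all add: comp restrict_UNIV)
qed

text \<open>A supremum of reals dominates the values only for a family bounded above; here the bound
  is 1.\<close>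

lemma cdf_le_SUP:
  assumes "real_distribution A" "real_distribution B"
  shows "\<bar>cdf A x - cdf B x\<bar> \<le> (SUP x. \<bar>cdf A x - cdf B x\<bar>)"
proof (rule cSUP_upper)
  interpret A: real_distribution A by fact
  interpret B: real_distribution B by fact
  have "\<bar>cdf A x - cdf B x\<bar> \<le> 1" for x
    using A.cdf_bounded_prob[of x] A.cdf_nonneg[of x] B.cdf_bounded_prob[of x] B.cdf_nonneg[of x]
    by linarith
  then show "bdd_above (range (\<lambda>x. \<bar>cdf A x - cdf B x\<bar>))"
    by (auto simp: bdd_above_def)
qed simp

text \<open>The coordinates of the infinite product of \<open>\<nu>\<close> form an i.i.d. sequence
  on exactly the type over which \<open>berry_esseen_constant\<close> quantifies.\<close>

lemma berry_esseen_constantD: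
  fixes \<nu> :: "real measure"
  assumes c: "berry_esseen_constant c" and \<nu>: "real_distribution \<nu>"
    and mean: "(LINT x|\<nu>. x) = 0" and var: "(LINT x|\<nu>. x\<^sup>2) = s\<^sup>2" and s: "0 < s"
    and int: "integrable \<nu> (\<lambda>x. \<bar>x\<bar> ^ 3)" and n: "1 \<le> n"
  shows "\<bar>cdf (distr (PiM UNIV (\<lambda>_::nat. \<nu>)) borel (\<lambda>\<omega>. (\<Sum>j<n. \<omega> j) / (s * sqrt n))) x
      - cdf std_normal_distribution x\<bar> \<le> c * (LINT x|\<nu>. \<bar>x\<bar> ^ 3) / (s ^ 3 * sqrt n)"
proof -
  interpret nu: real_distribution \<nu> by fact
  let ?P = "PiM UNIV (\<lambda>_::nat. \<nu>)"
  interpret P: prob_space ?P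
    by (rule prob_space_PiM) unfold_locales
  have [measurable_cong]: "sets \<nu> = sets borel" by simp
  note coord = indep_vars_PiM_coordinates[OF \<nu>]
  have lint: "(LINT \<omega>|?P. f (\<omega> 0)) = (LINT x|\<nu>. f x)" if [measurable]: "f \<in> borel_measurable borel" for f :: "real \<Rightarrow> real"
  proof -
    have "(LINT x|distr ?P borel (\<lambda>\<omega>. \<omega> 0). f x) = (LINT \<omega>|?P. f (\<omega> 0))"
      by (rule integral_distr) measurable
    then show ?thesis
      by (simp only: coord(2))
  qed
  have "integrable (distr ?P borel (\<lambda>\<omega>. \<omega> 0)) (\<lambda>x. \<bar>x\<bar> ^ 3)"
    using int by (simp only: coord(2))
  \<comment> \<open>The subtraction of \<open>0\<close> keeps the shape of the definition,
    instantiated with \<open>m = 0\<close>.\<close>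
  then have int0: "integrable ?P (\<lambda>\<omega>. \<bar>\<omega> 0 - 0\<bar> ^ 3)"
    by (subst (asm) integrable_distr_eq) simp_all
  have "(SUP x. \<bar>cdf (distr ?P borel (\<lambda>\<omega>. ((\<Sum>j<n. \<omega> j) - real n * 0) / (s * sqrt (real n)))) x
                - cdf std_normal_distribution x\<bar>)
       \<le> c * P.expectation (\<lambda>\<omega>. \<bar>\<omega> 0 - 0\<bar> ^ 3) / (s ^ 3 * sqrt (real n))"
  proof (rule c[unfolded berry_esseen_constant_def, THEN conjunct2, rule_format,
        where Y = "\<lambda>j \<omega>. \<omega> j"])
    show "prob_space ?P" by unfold_locales
    show "P.indep_vars (\<lambda>_. borel) (\<lambda>j \<omega>. \<omega> j) UNIV" by (rule coord(1))
    show "distr ?P borel (\<lambda>\<omega>. \<omega> j) = distr ?P borel (\<lambda>\<omega>. \<omega> 0)" for j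
      by (simp only: coord(2))
    show 0: "0 = P.expectation (\<lambda>\<omega>. \<omega> 0)"
      using lint[of "\<lambda>x. x"] mean by simp
    show "s\<^sup>2 = P.variance (\<lambda>\<omega>. \<omega> 0)"
      unfolding 0[symmetric] using lint[of "\<lambda>x. x\<^sup>2"] var by simp
  qed (use s n int0 in auto)
  moreover have "real_distribution (distr ?P borel (\<lambda>\<omega>. ((\<Sum>j<n. \<omega> j) - real n * 0) / (s * sqrt (real n))))"
    by (rule P.real_distribution_distr) measurable
  ultimately show ?thesis
    using order_trans[OF cdf_le_SUP[OF _ real_dist_normal_dist]] lint[of "\<lambda>x. \<bar>x\<bar> ^ 3"]
    by simp
qed

text \<open>The time \<open>t\<close> stays fixed while the number \<open>n\<close> of summands
  grows. The normalised sum has the same law for every \<open>n\<close>, so \<open>n\<close> may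
  tend to infinity in the bound alone, which removes the remainder term.\<close>

lemma (in cubic_levy_measure) berry_esseen_infinitely_divisible:
  fixes \<nu> :: "real \<Rightarrow> real measure"
  assumes c: "berry_esseen_constant c" and \<sigma>: "0 < \<sigma>" "\<sigma>\<^sup>2 = kappa2" and t: "0 < t"
    and law: "\<And>h. 0 < h \<Longrightarrow> real_distribution (\<nu> h)"
    and char_law: "\<And>h z. 0 < h \<Longrightarrow> char (\<nu> h) z = exp (h * psi z)"
  shows "\<bar>cdf (distr (\<nu> t) borel (\<lambda>x. x / (\<sigma> * sqrt t))) y - cdf std_normal_distribution y\<bar>
      \<le> c * kappa3 / (\<sigma> ^ 3 * sqrt t)" (is "?L \<le> _")
proof -
  interpret nt: real_distribution "\<nu> t"
    by (rule law[OF t])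
  have "?L \<le> c * (kappa3 + t / real n * remainder_const) / (\<sigma> ^ 3 * sqrt t)" if n: "1 \<le> n" for n
  proof -
    define h where "h = t / real n"
    have h: "0 < h" "n * h = t"
      using t n by (simp_all add: h_def)
    interpret nh: real_distribution "\<nu> h"
      by (rule law[OF h(1)])
    let ?P = "PiM UNIV (\<lambda>_::nat. \<nu> h)"
    interpret P: prob_space ?P
      by (rule prob_space_PiM) unfold_locales
    have [measurable_cong]: "sets (\<nu> h) = sets borel" by simp
    note coord = indep_vars_PiM_coordinates[OF law[OF h(1)]]
    define a where "a = \<sigma> * sqrt t"
    have sqrt: "\<sigma> * sqrt h * sqrt n = a"
      using h by (simp add: a_def real_sqrt_mult[symmetric] mult.commute)
    \<comment> \<open>The independent copies live on a product space of their own; equality of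
      characteristic functions ties their sum to \<open>\<nu> t\<close>.\<close>
    have "distr ?P borel (\<lambda>\<omega>. (\<Sum>j<n. \<omega> j) / a) = distr (\<nu> t) borel (\<lambda>x. x / a)"
    proof (rule Levy_uniqueness)
      show "char (distr ?P borel (\<lambda>\<omega>. (\<Sum>j<n. \<omega> j) / a)) = char (distr (\<nu> t) borel (\<lambda>x. x / a))"
      proof
        fix z
        have "char (distr ?P borel (\<lambda>\<omega>. (\<Sum>j<n. \<omega> j) / a)) z
            = char (distr ?P borel (\<lambda>\<omega>. \<Sum>j<n. \<omega> j)) (z / a)"
          by (subst (1 2) P.char_distr) simp_all
        also have "\<dots> = (\<Prod>j<n. char (\<nu> h) (z / a))"
          by (subst P.char_distr_sum[OF P.indep_vars_subset[OF coord(1)]]) (simp_all add: coord(2))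
        also have "\<dots> = exp (of_nat n * complex_of_real h * psi (z / a))"
          using h by (simp add: char_law mult.assoc flip: exp_of_nat_mult)
        also have "of_nat n * complex_of_real h = complex_of_real t"
          using h(2) by (metis of_real_mult of_real_of_nat_eq)
        also have "exp (complex_of_real t * psi (z / a)) = char (distr (\<nu> t) borel (\<lambda>x. x / a)) z"
          using char_law[OF t, of "z / a"] by (subst nt.char_distr) (simp_all add: char_def)
        finally show "char (distr ?P borel (\<lambda>\<omega>. (\<Sum>j<n. \<omega> j) / a)) z
            = char (distr (\<nu> t) borel (\<lambda>x. x / a)) z" .
      qed
    qed (auto intro!: P.real_distribution_distr nt.real_distribution_distr)
    moreover have "\<bar>cdf (distr ?P borel (\<lambda>\<omega>. (\<Sum>j<n. \<omega> j) / (\<sigma> * sqrt h * sqrt n))) y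
        - cdf std_normal_distribution y\<bar>
        \<le> c * (LINT x|\<nu> h. \<bar>x\<bar> ^ 3) / ((\<sigma> * sqrt h) ^ 3 * sqrt n)"
    proof (rule berry_esseen_constantD[OF c law[OF h(1)] _ _ _ _ n])
      show "(LINT x|\<nu> h. x) = 0" "(LINT x|\<nu> h. x\<^sup>2) = (\<sigma> * sqrt h)\<^sup>2" "integrable (\<nu> h) (\<lambda>x. \<bar>x\<bar> ^ 3)"
        using moments_law[OF law[OF h(1)] less_imp_le[OF h(1)] char_law[OF h(1)]]
          abs_third_moment_law(1)[OF law[OF h(1)] less_imp_le[OF h(1)] char_law[OF h(1)]] h \<sigma>
        by (simp_all add: power_mult_distrib)
      show "0 < \<sigma> * sqrt h"
        using \<sigma> h by simp
    qed
    ultimately have "?L \<le> c * (LINT x|\<nu> h. \<bar>x\<bar> ^ 3) / ((\<sigma> * sqrt h) ^ 3 * sqrt n)"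
      by (simp only: sqrt a_def)
    \<comment> \<open>Because \<open>n * h = t\<close>, one factor \<open>h\<close> splits off the
      denominator; it cancels the factor \<open>h\<close> of the third moment bound.\<close>
    also have "(\<sigma> * sqrt h) ^ 3 * sqrt n = h * (\<sigma> ^ 3 * sqrt t)"
    proof -
      have "(\<sigma> * sqrt h) ^ 3 * sqrt n = (sqrt h * sqrt h) * \<sigma>\<^sup>2 * (\<sigma> * sqrt h * sqrt n)"
        by (simp add: power2_eq_square power3_eq_cube)
      also have "\<dots> = h * (\<sigma> ^ 3 * sqrt t)"
        unfolding sqrt using h by (simp add: a_def power2_eq_square power3_eq_cube)
      finally show ?thesis .
    qed
    also have "c * (LINT x|\<nu> h. \<bar>x\<bar> ^ 3) / (h * (\<sigma> ^ 3 * sqrt t))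
        \<le> c * (h * kappa3 + h\<^sup>2 * remainder_const) / (h * (\<sigma> ^ 3 * sqrt t))"
      using c \<sigma> h t
      by (intro divide_right_mono mult_left_mono
          abs_third_moment_law(2)[OF law[OF h(1)] less_imp_le[OF h(1)] char_law[OF h(1)]])
         (simp_all add: berry_esseen_constant_def)
    also have "h * kappa3 + h\<^sup>2 * remainder_const = h * (kappa3 + h * remainder_const)"
      by (simp add: power2_eq_square algebra_simps)
    also have "c * (h * (kappa3 + h * remainder_const)) / (h * (\<sigma> ^ 3 * sqrt t))
        = c * (kappa3 + h * remainder_const) / (\<sigma> ^ 3 * sqrt t)"
      using h by simp
    finally show ?thesis
      by (simp add: h_def)
  qed
  moreover have "(\<lambda>n. c * (kappa3 + t / real n * remainder_const) / (\<sigma> ^ 3 * sqrt t))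
      \<longlonglongrightarrow> c * (kappa3 + 0 * remainder_const) / (\<sigma> ^ 3 * sqrt t)"
    using \<sigma> t by (intro tendsto_intros lim_const_over_n) auto
  ultimately show ?thesis
    by (intro tendsto_lowerbound[OF _ _ trivial_limit_sequentially])
       (auto simp: eventually_sequentially intro!: exI[of _ 1])
qed

section \<open>Moments of the tempered stable Levy measure\<close>

text \<open>Euler's integral after rescaling by \<open>l\<close>. Passing from \<open>{0..}\<close>
  to \<open>{0<..}\<close> is harmless pointwise, as \<open>0 powr y = 0\<close>.\<close>

lemma has_bochner_integral_gamma_kernel:
  fixes p l :: real
  assumes p: "0 < p" and l: "0 < l"
  shows "has_bochner_integral lborel (\<lambda>x. indicator {0<..} x * x powr (p - 1) * exp (- l * x)) (Gamma p / l powr p)"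
proof -
  let ?f = "\<lambda>x::real. indicator {0..} x * x powr (p - 1) / exp x"
  have "has_bochner_integral lborel ?f (Gamma p)"
  proof (rule has_bochner_integral_nn_integral)
    show "(\<integral>\<^sup>+x. ennreal (?f x) \<partial>lborel) = ennreal (Gamma p)"
      by (rule Gamma_conv_nn_integral_real[OF p, symmetric])
  qed (use p in \<open>auto simp: Gamma_real_pos less_imp_le\<close>)
  then have "has_bochner_integral lborel (\<lambda>x. ?f (0 + l * x)) (Gamma p /\<^sub>R \<bar>l\<bar>)"
    using l lborel_has_bochner_integral_real_affine_iff[of l ?f "Gamma p" 0] by simp
  then have "has_bochner_integral lborel (\<lambda>x. l powr (1 - p) * ?f (0 + l * x)) (l powr (1 - p) * (Gamma p /\<^sub>R \<bar>l\<bar>))"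
    by (rule has_bochner_integral_mult_right)
  moreover have "l powr (1 - p) * ?f (0 + l * x) = indicator {0<..} x * x powr (p - 1) * exp (- l * x)" for x
  proof (cases "x > 0")
    case True
    then show ?thesis
      using l by (simp add: powr_mult powr_diff exp_minus field_simps)
  qed (use l in \<open>auto simp: indicator_def zero_le_mult_iff\<close>)
  moreover have "l powr (1 - p) * (Gamma p /\<^sub>R \<bar>l\<bar>) = Gamma p / l powr p"
    using l by (simp add: powr_diff field_simps)
  ultimately show ?thesis by simp
qed

text \<open>Separate weights on the half-lines cover all cases at once: \<open>a = 1\<close>,
  \<open>b = -1\<close> for the first moment, \<open>a = b = 1\<close> for the second and the
  absolute third. The conditions \<open>\<beta>p < real n\<close> and
  \<open>\<beta>m < real n\<close> give convergence at 0.\<close>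

lemma has_bochner_integral_ts_density:
  fixes n :: nat and \<beta>p \<beta>m :: real
  assumes "0 < lp" "0 < lm" "\<beta>p < real n" "\<beta>m < real n"
  shows "has_bochner_integral lborel
      (\<lambda>x. ts_levy_density \<alpha>p \<beta>p lp \<alpha>m \<beta>m lm x * (if 0 \<le> x then a * \<bar>x\<bar> ^ n else b * \<bar>x\<bar> ^ n))
      (a * (\<alpha>p * (Gamma (real n - \<beta>p) / lp powr (real n - \<beta>p))) + b * (\<alpha>m * (Gamma (real n - \<beta>m) / lm powr (real n - \<beta>m))))"
proof -
  define k where "k \<beta> l x = indicator {0<..} x * x powr (real n - \<beta> - 1) * exp (- l * x)" for \<beta> l x :: real
  have k: "has_bochner_integral lborel (k \<beta> l) (Gamma (real n - \<beta>) / l powr (real n - \<beta>))"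
    if "\<beta> < real n" "0 < l" for \<beta> l
    unfolding k_def using that by (intro has_bochner_integral_gamma_kernel) simp_all
  have k': "has_bochner_integral lborel (\<lambda>x. k \<beta> l (- x)) (Gamma (real n - \<beta>) / l powr (real n - \<beta>))"
    if "\<beta> < real n" "0 < l" for \<beta> l
    using lborel_has_bochner_integral_real_affine_iff[of "-1" "k \<beta> l" "Gamma (real n - \<beta>) / l powr (real n - \<beta>)" 0]
      k[OF that] by simp
  have pow: "x ^ n / x powr (1 + \<beta>) = x powr (real n - \<beta> - 1)" if "0 < x" for x \<beta> :: real
    using that by (simp add: powr_diff powr_add powr_realpow)
  have "ts_levy_density \<alpha>p \<beta>p lp \<alpha>m \<beta>m lm x * (if 0 \<le> x then a * \<bar>x\<bar> ^ n else b * \<bar>x\<bar> ^ n)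
      = a * (\<alpha>p * k \<beta>p lp x) + b * (\<alpha>m * k \<beta>m lm (- x))" for x
  proof -
    consider "x > 0" | "x = 0" | "x < 0" by linarith
    then show ?thesis
    proof cases
      case 1
      then show ?thesis
        using pow[of x \<beta>p] by (simp add: ts_levy_density_def k_def field_simps)
    next
      case 2
      then show ?thesis by (simp add: ts_levy_density_def k_def)
    next
      case 3
      then show ?thesis
        using pow[of "- x" \<beta>m] by (simp add: ts_levy_density_def k_def field_simps)
    qed
  qed
  then show ?thesis
    using assms by (simp only:) (intro has_bochner_integral_add has_bochner_integral_mult_right k k')
qed

lemma ts_levy_density_measurable [measurable]:
  "ts_levy_density \<alpha>p \<beta>p lp \<alpha>m \<beta>m lm \<in> borel_measurable borel"
  unfolding ts_levy_density_def[abs_def] by measurable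

lemma ts_levy_density_nonneg: "0 \<le> \<alpha>p \<Longrightarrow> 0 \<le> \<alpha>m \<Longrightarrow> 0 \<le> ts_levy_density \<alpha>p \<beta>p lp \<alpha>m \<beta>m lm x"
  by (simp add: ts_levy_density_def)

lemma has_bochner_integral_ts_levy_measure:
  fixes n :: nat and \<beta>p \<beta>m :: real
  assumes "0 \<le> \<alpha>p" "0 \<le> \<alpha>m" "0 < lp" "0 < lm" "\<beta>p < real n" "\<beta>m < real n"
    and f: "\<And>x. f x = (if 0 \<le> x then a * \<bar>x\<bar> ^ n else b * \<bar>x\<bar> ^ n)"
  shows "has_bochner_integral (ts_levy_measure \<alpha>p \<beta>p lp \<alpha>m \<beta>m lm) f
      (a * (\<alpha>p * (Gamma (real n - \<beta>p) / lp powr (real n - \<beta>p))) + b * (\<alpha>m * (Gamma (real n - \<beta>m) / lm powr (real n - \<beta>m))))"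
proof -
  have [measurable]: "f \<in> borel_measurable borel"
    unfolding f[abs_def] by measurable
  show ?thesis
    unfolding ts_levy_measure_def
    using has_bochner_integral_ts_density[OF assms(3-6), of \<alpha>p \<alpha>m a b] assms(1,2)
    by (intro has_bochner_integral_density) (simp_all add: f[abs_def] ts_levy_density_nonneg)
qed

lemma Gamma_powr_recurrence:
  fixes p l :: real
  assumes "0 < p" "0 < l"
  shows "Gamma (1 + p) / l powr (1 + p) = p / l * (Gamma p / l powr p)"
  using assms Gamma_plus1[of p] by (simp add: powr_add add.commute nonpos_Ints_def)

text \<open>\<open>A\<close> and \<open>B\<close> are the integrals of \<open>\<bar>x\<bar>\<close>
  over the two half-lines. \<open>Gamma_powr_recurrence\<close> expresses the higher moments through
  them, so that Gamma values can be eliminated later.\<close>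

lemma ts_levy_measure_cubic:
  assumes "0 < \<alpha>p" "0 < lp" "0 < \<alpha>m" "0 < lm" "\<beta>p < 1" "\<beta>m < 1"
  defines "F \<equiv> ts_levy_measure \<alpha>p \<beta>p lp \<alpha>m \<beta>m lm"
    and "A \<equiv> \<alpha>p * (Gamma (1 - \<beta>p) / lp powr (1 - \<beta>p))"
    and "B \<equiv> \<alpha>m * (Gamma (1 - \<beta>m) / lm powr (1 - \<beta>m))"
  shows "cubic_levy_measure F"
    and "(LINT x|F. x) = A - B"
    and "(LINT x|F. x\<^sup>2) = (1 - \<beta>p) / lp * A + (1 - \<beta>m) / lm * B"
    and "(LINT x|F. \<bar>x\<bar> ^ 3) = (1 - \<beta>p) * (2 - \<beta>p) / lp\<^sup>2 * A + (1 - \<beta>m) * (2 - \<beta>m) / lm\<^sup>2 * B"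
proof -
  note mom = has_bochner_integral_ts_levy_measure[OF less_imp_le[OF assms(1)] less_imp_le[OF assms(3)] assms(2,4), folded F_def]
  have m1: "has_bochner_integral F (\<lambda>x. x) (A - B)"
    using mom[where n = 1 and a = 1 and b = "-1" and f = "\<lambda>x. x" and \<beta>p = \<beta>p and \<beta>m = \<beta>m] assms(5,6)
    by (simp add: A_def B_def F_def)
  have G2: "Gamma (2 - \<beta>) / l powr (2 - \<beta>) = (1 - \<beta>) / l * (Gamma (1 - \<beta>) / l powr (1 - \<beta>))"
    if "\<beta> < 1" "0 < l" for \<beta> l :: real
    using Gamma_powr_recurrence[of "1 - \<beta>" l] that by simp
  have G3: "Gamma (3 - \<beta>) / l powr (3 - \<beta>) = (1 - \<beta>) * (2 - \<beta>) / l\<^sup>2 * (Gamma (1 - \<beta>) / l powr (1 - \<beta>))"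
    if "\<beta> < 1" "0 < l" for \<beta> l :: real
    using Gamma_powr_recurrence[of "2 - \<beta>" l] G2[OF that] that by (simp add: power2_eq_square mult_ac)
  have "has_bochner_integral F (\<lambda>x. x\<^sup>2)
      (\<alpha>p * (Gamma (2 - \<beta>p) / lp powr (2 - \<beta>p)) + \<alpha>m * (Gamma (2 - \<beta>m) / lm powr (2 - \<beta>m)))"
    using mom[where n = 2 and a = 1 and b = 1 and f = "\<lambda>x. x\<^sup>2" and \<beta>p = \<beta>p and \<beta>m = \<beta>m] assms(5,6)
    by (simp add: F_def)
  then have m2: "has_bochner_integral F (\<lambda>x. x\<^sup>2) ((1 - \<beta>p) / lp * A + (1 - \<beta>m) / lm * B)"
    using assms(2,4,5,6) by (simp only: G2 A_def B_def mult.left_commute)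
  have "has_bochner_integral F (\<lambda>x. \<bar>x\<bar> ^ 3)
      (\<alpha>p * (Gamma (3 - \<beta>p) / lp powr (3 - \<beta>p)) + \<alpha>m * (Gamma (3 - \<beta>m) / lm powr (3 - \<beta>m)))"
    using mom[where n = 3 and a = 1 and b = 1 and f = "\<lambda>x. \<bar>x\<bar> ^ 3" and \<beta>p = \<beta>p and \<beta>m = \<beta>m] assms(5,6)
    by (simp add: F_def)
  then have m3: "has_bochner_integral F (\<lambda>x. \<bar>x\<bar> ^ 3)
      ((1 - \<beta>p) * (2 - \<beta>p) / lp\<^sup>2 * A + (1 - \<beta>m) * (2 - \<beta>m) / lm\<^sup>2 * B)"
    using assms(2,4,5,6) by (simp only: G3 A_def B_def mult.left_commute)
  have "sigma_finite_measure F"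
    unfolding F_def ts_levy_measure_def
    by (subst sigma_finite_measure.sigma_finite_iff_density_finite[OF lborel.sigma_finite_measure_axioms]) simp_all
  then show "cubic_levy_measure F"
    using m1 m3 by (auto simp: cubic_levy_measure_def cubic_levy_measure_axioms_def
        has_bochner_integral_iff F_def ts_levy_measure_def)
  show "(LINT x|F. x) = A - B"
    "(LINT x|F. x\<^sup>2) = (1 - \<beta>p) / lp * A + (1 - \<beta>m) / lm * B"
    "(LINT x|F. \<bar>x\<bar> ^ 3) = (1 - \<beta>p) * (2 - \<beta>p) / lp\<^sup>2 * A + (1 - \<beta>m) * (2 - \<beta>m) / lm\<^sup>2 * B"
    using m1 m2 m3 by (simp_all only: has_bochner_integral_integral_eq)
qed

section \<open>Normal approximation of tempered stable processes\<close>

lemma (in brownian_motion) cdf_standardized: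
  assumes \<sigma>: "0 < \<sigma>" and t: "0 < t"
  shows "cdf (distr M borel (W t)) x = cdf std_normal_distribution ((x - \<mu> * t) / (\<sigma> * sqrt t))"
proof -
  have [measurable]: "random_variable borel (W t)" "random_variable borel (W 0)"
    using t by (auto intro!: rv)
  have "distributed M lborel (\<lambda>\<omega>. W t \<omega> - W 0 \<omega>) (normal_density (\<mu> * t) (\<sigma> * sqrt t))"
    using normal_increments[of 0 t] t by simp
  then have "distributed M lborel (\<lambda>\<omega>. (W t \<omega> - W 0 \<omega> - \<mu> * t) / (\<sigma> * sqrt t)) std_normal_density"
    using \<sigma> t by (subst (asm) normal_standard_normal_convert) simp_all
  then have std: "std_normal_distribution = distr M borel (\<lambda>\<omega>. (W t \<omega> - W 0 \<omega> - \<mu> * t) / (\<sigma> * sqrt t))"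
    by (simp add: distributed_def cong: distr_cong)
  \<comment> \<open>The normal law is given for the increment from time 0, and \<open>W 0\<close>
    vanishes almost surely.\<close>
  also have "\<dots> = distr M borel (\<lambda>\<omega>. (W t \<omega> - \<mu> * t) / (\<sigma> * sqrt t))"
    using initial by (intro distr_cong_AE) auto
  finally have "cdf std_normal_distribution ((x - \<mu> * t) / (\<sigma> * sqrt t))
      = cdf (distr M borel (\<lambda>\<omega>. (W t \<omega> - \<mu> * t) / (\<sigma> * sqrt t))) ((x - \<mu> * t) / (\<sigma> * sqrt t))"
    by simp
  also have "\<dots> = cdf (distr M borel (W t)) x"
    using \<sigma> t by (simp add: cdf_def2 measure_distr vimage_def divide_le_cancel mult_less_0_iff)
  finally show ?thesis ..
qed

lemma levy_process_normal_approximation: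
  assumes X: "levy_process M X" and F: "cubic_levy_measure F"
    and char_1: "\<And>z. char (distr M borel (X 1)) z = exp (CLINT x|F. iexp (z * x) - 1)"
  defines "\<mu> \<equiv> prob_space.expectation M (X 1)"
  shows "\<mu> = (LINT x|F. x)" and "prob_space.variance M (X 1) = (LINT x|F. x\<^sup>2)"
    and "berry_esseen_constant c \<Longrightarrow> 0 < \<sigma> \<Longrightarrow> \<sigma>\<^sup>2 = prob_space.variance M (X 1) \<Longrightarrow> 0 < t \<Longrightarrow>
      \<bar>cdf (distr M borel (X t)) x - cdf std_normal_distribution ((x - \<mu> * t) / (\<sigma> * sqrt t))\<bar>
        \<le> c * (LINT x|F. \<bar>x\<bar> ^ 3) / (\<sigma> ^ 3 * sqrt t)"
proof -
  interpret levy_process M X by fact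
  interpret F: cubic_levy_measure F by fact
  define m where "m = (LINT x|F. x)"
  \<comment> \<open>Centering uses the first moment \<open>m\<close> of \<open>F\<close>, since
    integrability of \<open>X 1\<close> is still open; \<open>moments_law\<close> at time 1 then
    yields \<open>\<mu> = m\<close>.\<close>
  define \<nu> where "\<nu> h = distr M borel (\<lambda>\<omega>. X h \<omega> - h * m)" for h
  have [measurable]: "random_variable borel (X h)" if "0 < h" for h
    using that by (intro rv) simp
  have law: "real_distribution (\<nu> h)" if "0 < h" for h
    unfolding \<nu>_def by (rule real_distribution_distr) (use that in measurable)
  have char_law: "char (\<nu> h) z = exp (h * F.psi z)" if h: "0 < h" for h z
  proof -
    have "char (\<nu> h) z = (CLINT \<omega>|M. iexp (z * (X h \<omega> - h * m)))"
      unfolding \<nu>_def by (rule char_distr) (use h in measurable)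
    also have "\<dots> = (CLINT \<omega>|M. iexp (z * X h \<omega>) * exp (- (\<i> * (z * h * m))))"
      by (simp add: algebra_simps flip: exp_add)
    also have "\<dots> = char (distr M borel (X h)) z * exp (- (\<i> * (z * h * m)))"
      using h by (simp add: char_distr rv)
    also have "char (distr M borel (X h)) z = exp (h * (CLINT x|F. iexp (z * x) - 1))"
      using h by (intro char_eq_exp F.continuous_integral_iexp_minus_one char_1) simp_all
    also have "(CLINT x|F. iexp (z * x) - 1) = F.psi z + \<i> * (z * m)"
      unfolding m_def by (rule F.integral_iexp_minus_one)
    finally show ?thesis
      by (simp add: algebra_simps flip: exp_add)
  qed
  note law1 = law[OF zero_less_one] zero_le_one char_law[OF zero_less_one]
  have int: "integrable M (\<lambda>\<omega>. X 1 \<omega> - 1 * m)"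
    using F.integrable_id_law[OF law1] unfolding \<nu>_def by (subst (asm) integrable_distr_eq) simp_all
  have "(LINT \<omega>|M. X 1 \<omega> - 1 * m) = 0"
    using F.moments_law(1)[OF law1] unfolding \<nu>_def by (subst (asm) integral_distr) simp_all
  moreover have "integrable M (X 1)"
    using Bochner_Integration.integrable_add[OF int integrable_const[of m]] by simp
  ultimately have \<mu>: "\<mu> = m"
    by (simp add: \<mu>_def prob_space)
  then show "\<mu> = (LINT x|F. x)"
    by (simp add: m_def)
  have "(LINT \<omega>|M. (X 1 \<omega> - 1 * m)\<^sup>2) = F.kappa2"
    using F.moments_law(2)[OF law1] unfolding \<nu>_def by (subst (asm) integral_distr) simp_all
  then show var: "variance (X 1) = (LINT x|F. x\<^sup>2)"
    using \<mu> by (simp add: \<mu>_def F.kappa2_def)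
  assume c: "berry_esseen_constant c" and \<sigma>: "0 < \<sigma>" "\<sigma>\<^sup>2 = variance (X 1)" and t: "0 < t"
  let ?y = "(x - \<mu> * t) / (\<sigma> * sqrt t)"
  have "distr (\<nu> t) borel (\<lambda>x. x / (\<sigma> * sqrt t)) = distr M borel (\<lambda>\<omega>. (X t \<omega> - t * m) / (\<sigma> * sqrt t))"
    unfolding \<nu>_def using t by (subst distr_distr) (simp_all add: comp_def)
  then have "cdf (distr (\<nu> t) borel (\<lambda>x. x / (\<sigma> * sqrt t))) ?y
      = cdf (distr M borel (\<lambda>\<omega>. (X t \<omega> - t * m) / (\<sigma> * sqrt t))) ?y"
    by simp
  also have "\<dots> = cdf (distr M borel (X t)) x"
    using \<sigma> t by (simp add: cdf_def2 measure_distr vimage_def divide_le_cancel mult_less_0_iff \<mu> mult.commute)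
  finally have "cdf (distr (\<nu> t) borel (\<lambda>x. x / (\<sigma> * sqrt t))) ?y = cdf (distr M borel (X t)) x" .
  then show "\<bar>cdf (distr M borel (X t)) x - cdf std_normal_distribution ?y\<bar>
        \<le> c * (LINT x|F. \<bar>x\<bar> ^ 3) / (\<sigma> ^ 3 * sqrt t)"
    using F.berry_esseen_infinitely_divisible[OF c \<sigma>(1) _ t law char_law, of ?y] var \<sigma>
    by (simp add: F.kappa2_def F.kappa3_def)
qed

text \<open>Cramer's rule for the two equations in \<open>A\<close> and \<open>B\<close>, whose
  determinant is \<open>(q * lp + p * lm) / (lp * lm)\<close>. In the application
  \<open>p = 1 - \<beta>p\<close> and \<open>q = 1 - \<beta>m\<close>.\<close>

lemma ts_third_moment_eq:
  fixes A B p q lp lm \<sigma> \<mu> :: real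
  assumes pos: "0 < lp" "0 < lm" "0 < p" "0 < q" "0 < \<sigma>"
    and \<mu>: "\<mu> = A - B" and \<sigma>: "\<sigma>\<^sup>2 = p / lp * A + q / lm * B"
  shows "(q * \<mu> / \<sigma> ^ 3 + lm / \<sigma>) / (lp * (q * lp + p * lm)) = A / (lp\<^sup>2 * \<sigma> ^ 3)"
    and "(- p * \<mu> / \<sigma> ^ 3 + lp / \<sigma>) / (lm * (q * lp + p * lm)) = B / (lm\<^sup>2 * \<sigma> ^ 3)"
proof -
  let ?D = "q * lp + p * lm"
  have D: "0 < ?D"
    using pos by (simp add: add_pos_pos)
  have "l / \<sigma> = l * \<sigma>\<^sup>2 / \<sigma> ^ 3" for l
    using pos by (simp add: power2_eq_square power3_eq_cube)
  then have eq: "a * \<mu> / \<sigma> ^ 3 + l / \<sigma> = (a * \<mu> + l * \<sigma>\<^sup>2) / \<sigma> ^ 3" for a l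
    by (simp add: add_divide_distrib)
  have "q * \<mu> + lm * \<sigma>\<^sup>2 = A * ?D / lp" "- p * \<mu> + lp * \<sigma>\<^sup>2 = B * ?D / lm"
    unfolding \<mu> \<sigma> using pos by (simp_all add: field_simps)
  then show "(q * \<mu> / \<sigma> ^ 3 + lm / \<sigma>) / (lp * ?D) = A / (lp\<^sup>2 * \<sigma> ^ 3)"
    "(- p * \<mu> / \<sigma> ^ 3 + lp / \<sigma>) / (lm * ?D) = B / (lm\<^sup>2 * \<sigma> ^ 3)"
    unfolding eq using pos D by (simp_all add: power2_eq_square)
qed

theorem theorem4p10:
  fixes \<alpha>p \<beta>p lp \<alpha>m \<beta>m lm \<mu> \<sigma> c :: real
    and M :: "'a measure" and X :: "real \<Rightarrow> 'a \<Rightarrow> real"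
    and N :: "'b measure" and W :: "real \<Rightarrow> 'b \<Rightarrow> real"
  assumes "\<alpha>p > 0" and "lp > 0" and "\<alpha>m > 0" and "lm > 0"
    and "0 \<le> \<beta>p" and "\<beta>p < 1" and "0 \<le> \<beta>m" and "\<beta>m < 1"
    and "tempered_stable_process M X \<alpha>p \<beta>p lp \<alpha>m \<beta>m lm"
    and "\<mu> = prob_space.expectation M (X 1)"
    and "\<sigma>\<^sup>2 = prob_space.variance M (X 1)" and "\<sigma> > 0"
    and "brownian_motion N W \<mu> \<sigma>"
    and "berry_esseen_constant c"
  shows "let R = (\<lambda>t. 32 * c / sqrt t *
           ((1 - \<beta>p) * (2 - \<beta>p) *
              (((1 - \<beta>m) * \<mu> / \<sigma> ^ 3 + lm / \<sigma>)
                / (lp * ((1 - \<beta>m) * lp + (1 - \<beta>p) * lm)))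
          + (1 - \<beta>m) * (2 - \<beta>m) *
              (((\<beta>p - 1) * \<mu> / \<sigma> ^ 3 + lp / \<sigma>)
                / (lm * ((1 - \<beta>m) * lp + (1 - \<beta>p) * lm)))))
         in (\<forall>t>0. (SUP x. \<bar>cdf (distr M borel (X t)) x - cdf (distr N borel (W t)) x\<bar>) \<le> R t)
            \<and> (R \<longlongrightarrow> 0) at_top"
proof -
  interpret X: tempered_stable_process M X \<alpha>p \<beta>p lp \<alpha>m \<beta>m lm by fact
  interpret W: brownian_motion N W \<mu> \<sigma> by fact
  define F where "F = ts_levy_measure \<alpha>p \<beta>p lp \<alpha>m \<beta>m lm"
  define A where "A = \<alpha>p * (Gamma (1 - \<beta>p) / lp powr (1 - \<beta>p))"
  define B where "B = \<alpha>m * (Gamma (1 - \<beta>m) / lm powr (1 - \<beta>m))"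
  note F = ts_levy_measure_cubic[OF assms(1-4,6,8), folded F_def A_def B_def]
  have char_1: "char (distr M borel (X 1)) z = exp (CLINT x|F. iexp (z * x) - 1)" for z
    using X.law_1 by (simp add: tempered_stable_distribution_def F_def)
  \<comment> \<open>Folding replaces the expectation and variance by \<open>\<mu>\<close> and
    \<open>\<sigma>\<^sup>2\<close>; hence \<open>refl\<close> settles the variance condition
    below.\<close>
  note approx = levy_process_normal_approximation[OF X.levy_process_axioms F(1) char_1, folded assms(10,11)]
  define \<kappa> where "\<kappa> = (LINT x|F. \<bar>x\<bar> ^ 3)"
  have \<kappa>_nonneg: "0 \<le> \<kappa>"
    by (simp add: \<kappa>_def)
  have c: "0 < c"
    using assms(14) by (simp add: berry_esseen_constant_def)
  have "\<mu> = A - B" "\<sigma>\<^sup>2 = (1 - \<beta>p) / lp * A + (1 - \<beta>m) / lm * B"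
    using approx(1,2) F(2,3) by simp_all
  note third = ts_third_moment_eq[OF assms(2,4) _ _ assms(12) this]
  \<comment> \<open>By \<open>third\<close> the two fractions are
    \<open>A / (lp\<^sup>2 * \<sigma> ^ 3)\<close> and
    \<open>B / (lm\<^sup>2 * \<sigma> ^ 3)\<close>, and \<open>F(4)\<close> recognises their
    combination as the third absolute moment over \<open>\<sigma> ^ 3\<close>.\<close>
  have "(1 - \<beta>p) * (2 - \<beta>p) * (((1 - \<beta>m) * \<mu> / \<sigma> ^ 3 + lm / \<sigma>)
                / (lp * ((1 - \<beta>m) * lp + (1 - \<beta>p) * lm)))
          + (1 - \<beta>m) * (2 - \<beta>m) * (((\<beta>p - 1) * \<mu> / \<sigma> ^ 3 + lp / \<sigma>)
                / (lm * ((1 - \<beta>m) * lp + (1 - \<beta>p) * lm))) = \<kappa> / \<sigma> ^ 3"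
    using third assms(6,8) by (simp add: \<kappa>_def F(4) add_divide_distrib)
  moreover have "(SUP x. \<bar>cdf (distr M borel (X t)) x - cdf (distr N borel (W t)) x\<bar>)
      \<le> 32 * c / sqrt t * (\<kappa> / \<sigma> ^ 3)" if t: "0 < t" for t
  proof (rule cSUP_least)
    fix x
    have "\<bar>cdf (distr M borel (X t)) x - cdf (distr N borel (W t)) x\<bar> \<le> c * \<kappa> / (\<sigma> ^ 3 * sqrt t)"
      unfolding W.cdf_standardized[OF assms(12) t] \<kappa>_def
      by (rule approx(3)[OF assms(14) assms(12) refl t])
    also have "\<dots> \<le> 32 * (c * \<kappa> / (\<sigma> ^ 3 * sqrt t))"
    proof -
      have "a \<le> 32 * a" if "0 \<le> a" for a :: real
        using that by simp
      then show ?thesis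
        by (this) (use c \<kappa>_nonneg assms(12) t in simp)
    qed
    finally show "\<bar>cdf (distr M borel (X t)) x - cdf (distr N borel (W t)) x\<bar>
        \<le> 32 * c / sqrt t * (\<kappa> / \<sigma> ^ 3)"
      by (simp add: mult_ac)
  qed simp
  moreover have "((\<lambda>t. 32 * c / sqrt t * (\<kappa> / \<sigma> ^ 3)) \<longlongrightarrow> 0) at_top"
    by (intro tendsto_mult_left_zero tendsto_divide_0[OF tendsto_const]
        filterlim_at_top_imp_at_infinity sqrt_at_top)
  ultimately show ?thesis
    by simp
qed

end
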